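(* Let $T$ be a complete first-order theory. If there is a formula $\varphi(x,y)$ (with $x,y$ finite tuples of variables) that witnesses ATP in $T$, then there is a formula $\psi(x',z)$ with $x'$ a single variable ($|x'|=1$) that witnesses ATP in $T$.
   Context: Let $\mathbb{M}$ be a monster model of $T$. $2^{<\omega}$ is the set of finite $0/1$-strings; $\eta\trianglelefteq\nu$ means that $\eta$ is an initial segment of $\nu$; $\eta,\nu$ are comparable if $\eta\trianglelefteq\nu$ or $\nu\trianglelefteq\eta$. An antichain is a set of pairwise incomparable elements. A formula $\varphi(x,y)$ has (witnesses) the antichain tree property (ATP) if there is a family $(a_\eta)_{\eta\in 2^{<\omega}}$ of parameters in $\mathbb{M}$ such that (i) for every antichain $X\subseteq 2^{<\omega}$ the set $\{\varphi(x,a_\eta):\eta\in X\}$ is consistent, and (ii) for all $\eta,\nu\in 2^{<\omega}$ with $\eta\trianglelefteq\nu$ and $\eta\neq\nu$, the set $\{\varphi(x,a_\eta),\varphi(x,a_\nu)\}$ is inconsistent. In $\varphi(x,y)$, $x$ is the tuple of free (object) variables and $y$ the tuple of parameter variables. *)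

theory Defs
  imports "HOL-Library.Sublist"
begin

unbundle cardinal_syntax

text \<open>A symbol of a language is a name together with its arity.\<close>

record ('f, 'r) lang =
  fsyms :: "('f \<times> nat) set"
  rsyms :: "('r \<times> nat) set"

datatype 'f tm = Var nat | Fun 'f "'f tm list"

datatype ('f, 'r) form =
    Eq "'f tm" "'f tm"
  | Pred 'r "'f tm list"
  | Neg "('f, 'r) form"
  | Conj "('f, 'r) form" "('f, 'r) form"
  | Exists nat "('f, 'r) form"

fun tm_of :: "('f, 'r) lang \<Rightarrow> 'f tm \<Rightarrow> bool" where
  "tm_of L (Var v) \<longleftrightarrow> True"
| "tm_of L (Fun f ts) \<longleftrightarrow> (f, length ts) \<in> fsyms L \<and> (\<forall>t\<in>set ts. tm_of L t)"

primrec form_of :: "('f, 'r) lang \<Rightarrow> ('f, 'r) form \<Rightarrow> bool" where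
  "form_of L (Eq s t) \<longleftrightarrow> tm_of L s \<and> tm_of L t"
| "form_of L (Pred r ts) \<longleftrightarrow> (r, length ts) \<in> rsyms L \<and> (\<forall>t\<in>set ts. tm_of L t)"
| "form_of L (Neg \<phi>) \<longleftrightarrow> form_of L \<phi>"
| "form_of L (Conj \<phi> \<psi>) \<longleftrightarrow> form_of L \<phi> \<and> form_of L \<psi>"
| "form_of L (Exists v \<phi>) \<longleftrightarrow> form_of L \<phi>"

fun vars_tm :: "'f tm \<Rightarrow> nat set" where
  "vars_tm (Var v) = {v}"
| "vars_tm (Fun f ts) = (\<Union>t\<in>set ts. vars_tm t)"

primrec fv :: "('f, 'r) form \<Rightarrow> nat set" where
  "fv (Eq s t) = vars_tm s \<union> vars_tm t"
| "fv (Pred r ts) = (\<Union>t\<in>set ts. vars_tm t)"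
| "fv (Neg \<phi>) = fv \<phi>"
| "fv (Conj \<phi> \<psi>) = fv \<phi> \<union> fv \<psi>"
| "fv (Exists v \<phi>) = fv \<phi> - {v}"

definition formulas :: "('f, 'r) lang \<Rightarrow> ('f, 'r) form set" where
  "formulas L = {\<phi>. form_of L \<phi>}"

definition sentences :: "('f, 'r) lang \<Rightarrow> ('f, 'r) form set" where
  "sentences L = {\<phi> \<in> formulas L. fv \<phi> = {}}"

record ('f, 'r, 'm) struct =
  univ :: "'m set"
  fint :: "'f \<Rightarrow> 'm list \<Rightarrow> 'm"
  rint :: "'r \<Rightarrow> 'm list \<Rightarrow> bool"

definition tuples :: "('f, 'r, 'm) struct \<Rightarrow> nat \<Rightarrow> 'm list set" where
  "tuples M n = {as. length as = n \<and> set as \<subseteq> univ M}"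

definition structure_of :: "('f, 'r) lang \<Rightarrow> ('f, 'r, 'm) struct \<Rightarrow> bool" where
  "structure_of L M \<longleftrightarrow>
     univ M \<noteq> {} \<and> (\<forall>(f, n) \<in> fsyms L. \<forall>as \<in> tuples M n. fint M f as \<in> univ M)"

primrec tval :: "('f, 'r, 'm) struct \<Rightarrow> (nat \<Rightarrow> 'm) \<Rightarrow> 'f tm \<Rightarrow> 'm" where
  "tval M e (Var v) = e v"
| "tval M e (Fun f ts) = fint M f (map (tval M e) ts)"

primrec sat :: "('f, 'r, 'm) struct \<Rightarrow> (nat \<Rightarrow> 'm) \<Rightarrow> ('f, 'r) form \<Rightarrow> bool" where
  "sat M e (Eq s t) \<longleftrightarrow> tval M e s = tval M e t"
| "sat M e (Pred r ts) \<longleftrightarrow> rint M r (map (tval M e) ts)"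
| "sat M e (Neg \<phi>) \<longleftrightarrow> \<not> sat M e \<phi>"
| "sat M e (Conj \<phi> \<psi>) \<longleftrightarrow> sat M e \<phi> \<and> sat M e \<psi>"
| "sat M e (Exists v \<phi>) \<longleftrightarrow> (\<exists>a \<in> univ M. sat M (e(v := a)) \<phi>)"

definition is_model :: "('f, 'r) lang \<Rightarrow> ('f, 'r) form set \<Rightarrow> ('f, 'r, 'm) struct \<Rightarrow> bool" where
  "is_model L T M \<longleftrightarrow>
     structure_of L M \<and> (\<forall>\<sigma>\<in>T. \<forall>e. range e \<subseteq> univ M \<longrightarrow> sat M e \<sigma>)"

text \<open>
  HOL cannot quantify over all types, so satisfiability and entailment refer to structures whose
  universe is a subset of the type of formulas.  That type is infinite and at least as large as
  the set of formulas of the language, so by the downward Loewenheim-Skolem theorem (and since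
  universes may be arbitrary nonempty subsets, finite ones included) this is the usual notion.
\<close>

definition satisfiable :: "('f, 'r) lang \<Rightarrow> ('f, 'r) form set \<Rightarrow> bool" where
  "satisfiable L T \<longleftrightarrow> (\<exists>N :: ('f, 'r, ('f, 'r) form) struct. is_model L T N)"

definition entails :: "('f, 'r) lang \<Rightarrow> ('f, 'r) form set \<Rightarrow> ('f, 'r) form \<Rightarrow> bool" where
  "entails L T \<sigma> \<longleftrightarrow>
     (\<forall>N :: ('f, 'r, ('f, 'r) form) struct. is_model L T N \<longrightarrow> is_model L {\<sigma>} N)"

definition complete_theory :: "('f, 'r) lang \<Rightarrow> ('f, 'r) form set \<Rightarrow> bool" where
  "complete_theory L T \<longleftrightarrow>
     T \<subseteq> sentences L \<and> satisfiable L T \<and>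
     (\<forall>\<sigma> \<in> sentences L. entails L T \<sigma> \<or> entails L T (Neg \<sigma>))"

text \<open>
  A formula with parameters is a pair of a formula and an assignment: every free variable that is
  not one of the object variables under consideration is replaced by its value under the
  assignment.  The values of the assignment elsewhere are irrelevant.
\<close>

definition assign :: "(nat \<Rightarrow> 'm) \<Rightarrow> nat list \<Rightarrow> 'm list \<Rightarrow> nat \<Rightarrow> 'm" where
  "assign e vs as = (\<lambda>v. case map_of (zip vs as) v of None \<Rightarrow> e v | Some a \<Rightarrow> a)"

definition instance_of ::
  "('f, 'r) form \<Rightarrow> nat list \<Rightarrow> 'm list \<Rightarrow> ('f, 'r) form \<times> (nat \<Rightarrow> 'm)" where
  "instance_of \<phi> ys as = (\<phi>, assign (\<lambda>_. undefined) ys as)"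

definition realizes ::
  "('f, 'r, 'm) struct \<Rightarrow> nat list \<Rightarrow> 'm list \<Rightarrow> (('f, 'r) form \<times> (nat \<Rightarrow> 'm)) set \<Rightarrow> bool" where
  "realizes M xs bs \<Sigma> \<longleftrightarrow>
     bs \<in> tuples M (length xs) \<and> (\<forall>(\<phi>, e) \<in> \<Sigma>. sat M (assign e xs bs) \<phi>)"

text \<open>
  Consistency of a set of formulas in the object variables \<open>xs\<close> with parameters in \<open>M\<close> means
  consistency with the elementary diagram of \<open>M\<close>.  As the elementary diagram is complete, this
  says that every finite subset is realized in \<open>M\<close>.
\<close>

definition consistent ::
  "('f, 'r, 'm) struct \<Rightarrow> nat list \<Rightarrow> (('f, 'r) form \<times> (nat \<Rightarrow> 'm)) set \<Rightarrow> bool" where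
  "consistent M xs \<Sigma> \<longleftrightarrow> (\<forall>\<Sigma>\<^sub>0 \<subseteq> \<Sigma>. finite \<Sigma>\<^sub>0 \<longrightarrow> (\<exists>bs. realizes M xs bs \<Sigma>\<^sub>0))"

definition param_formulas ::
  "('f, 'r) lang \<Rightarrow> 'm set \<Rightarrow> nat list \<Rightarrow> (('f, 'r) form \<times> (nat \<Rightarrow> 'm)) set" where
  "param_formulas L A xs = {(\<phi>, e). \<phi> \<in> formulas L \<and> e ` (fv \<phi> - set xs) \<subseteq> A}"

definition saturated :: "('f, 'r) lang \<Rightarrow> 'k rel \<Rightarrow> ('f, 'r, 'm) struct \<Rightarrow> bool" where
  "saturated L \<kappa> M \<longleftrightarrow>
     (\<forall>A \<Sigma> x. A \<subseteq> univ M \<and> |A| <o \<kappa> \<and> \<Sigma> \<subseteq> param_formulas L A [x] \<and> consistent M [x] \<Sigma>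
        \<longrightarrow> (\<exists>b. realizes M [x] [b] \<Sigma>))"

definition partial_elementary ::
  "('f, 'r) lang \<Rightarrow> ('f, 'r, 'm) struct \<Rightarrow> 'm set \<Rightarrow> ('m \<Rightarrow> 'm) \<Rightarrow> bool" where
  "partial_elementary L M A g \<longleftrightarrow>
     A \<subseteq> univ M \<and> g ` A \<subseteq> univ M \<and>
     (\<forall>\<phi> \<in> formulas L. \<forall>e. e ` fv \<phi> \<subseteq> A \<longrightarrow> (sat M e \<phi> \<longleftrightarrow> sat M (g \<circ> e) \<phi>))"

definition automorphism ::
  "('f, 'r) lang \<Rightarrow> ('f, 'r, 'm) struct \<Rightarrow> ('m \<Rightarrow> 'm) \<Rightarrow> bool" where
  "automorphism L M h \<longleftrightarrow>
     bij_betw h (univ M) (univ M) \<and>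
     (\<forall>(f, n) \<in> fsyms L. \<forall>as \<in> tuples M n. h (fint M f as) = fint M f (map h as)) \<and>
     (\<forall>(r, n) \<in> rsyms L. \<forall>as \<in> tuples M n. rint M r as \<longleftrightarrow> rint M r (map h as))"

definition strongly_homogeneous ::
  "('f, 'r) lang \<Rightarrow> 'k rel \<Rightarrow> ('f, 'r, 'm) struct \<Rightarrow> bool" where
  "strongly_homogeneous L \<kappa> M \<longleftrightarrow>
     (\<forall>A g. partial_elementary L M A g \<and> |A| <o \<kappa>
        \<longrightarrow> (\<exists>h. automorphism L M h \<and> (\<forall>a\<in>A. h a = g a)))"

text \<open>
  The cardinal \<open>\<kappa>\<close> bounds the small sets; it exceeds the number of formulas of the language
  (hence is uncountable), and no further largeness is required of it.
\<close>

definition monster_model ::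
  "('f, 'r) lang \<Rightarrow> ('f, 'r) form set \<Rightarrow> 'k rel \<Rightarrow> ('f, 'r, 'm) struct \<Rightarrow> bool" where
  "monster_model L T \<kappa> M \<longleftrightarrow>
     is_model L T M \<and> Card_order \<kappa> \<and> |formulas L| <o \<kappa> \<and>
     saturated L \<kappa> M \<and> strongly_homogeneous L \<kappa> M"

definition antichain :: "bool list set \<Rightarrow> bool" where
  "antichain X \<longleftrightarrow> pairwise parallel X"

definition witnesses_ATP ::
  "('f, 'r) lang \<Rightarrow> ('f, 'r, 'm) struct \<Rightarrow> ('f, 'r) form \<Rightarrow> nat list \<Rightarrow> nat list \<Rightarrow> bool" where
  "witnesses_ATP L M \<phi> xs ys \<longleftrightarrow>
     \<phi> \<in> formulas L \<and> distinct (xs @ ys) \<and> fv \<phi> \<subseteq> set (xs @ ys) \<and>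
     (\<exists>a :: bool list \<Rightarrow> 'm list.
        (\<forall>\<eta>. a \<eta> \<in> tuples M (length ys)) \<and>
        (\<forall>X. antichain X \<longrightarrow> consistent M xs {instance_of \<phi> ys (a \<eta>) | \<eta>. \<eta> \<in> X}) \<and>
        (\<forall>\<eta> \<nu>. prefix \<eta> \<nu> \<and> \<eta> \<noteq> \<nu> \<longrightarrow>
           \<not> consistent M xs {instance_of \<phi> ys (a \<eta>), instance_of \<phi> ys (a \<nu>)}))"

end

theory Submission
  imports Defs "HOL-Library.Countable" "HOL-Library.Infinite_Set" "HOL-Library.Ramsey"
begin

text \<open>
  Let \<open>\<phi>(x, x'; y)\<close> witness ATP with parameters \<open>a\<close>, where \<open>x\<close> is a single variable.  Call a finite set
  \<open>U\<close> of nodes satisfied if for some value \<open>b\<close> of \<open>x\<close> every antichain of instances \<open>\<phi>(b, x'; a\<^sub>\<eta>)\<close> with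
  \<open>\<eta> \<in> U\<close> is consistent.  If every finite binary tree is satisfied, then \<open>\<phi>(x'; x, y)\<close> witnesses ATP, with
  one object variable less; so suppose that no formula in one variable witnesses ATP and show that
  finite trees are satisfied.  By Ramsey's theorem one may assume that whether \<open>U\<close> is satisfied depends only on
  the shape of \<open>U\<close>.  The proof is by induction on the number of inner nodes of \<open>U\<close>.  Let \<open>w\<close> be an inner node
  of maximal length, so that the nodes \<open>V\<close> above \<open>w\<close> are leaves.  Move copies \<open>w\<^sub>\<zeta>\<close>, \<open>V\<^sub>\<zeta>\<close> of \<open>w\<close> and \<open>V\<close> into
  the space just above \<open>w\<close> so that \<open>w\<^sub>\<zeta>\<close> is incomparable to \<open>V\<^sub>\<zeta>\<close> but lies below \<open>V\<^sub>\<zeta>\<^sub>'\<close> for \<open>\<zeta>'\<close> above \<open>\<zeta>\<close>,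
  and keep the other nodes \<open>D\<close> fixed.  By the induction hypothesis, the formulas in \<open>x\<close> that say that \<open>x\<close>
  makes the antichains of \<open>D \<union> {w\<^sub>\<zeta>}\<close> and \<open>D \<union> V\<^sub>\<zeta>\<close> consistent are jointly consistent along antichains.  As they
  do not witness ATP, some \<open>b\<close> satisfies them for some \<open>\<zeta>\<close> and \<open>\<zeta>'\<close> above it, hence makes all antichains of
  \<open>D \<union> {w\<^sub>\<zeta>} \<union> V\<^sub>\<zeta>\<^sub>'\<close> consistent.  This set has the shape of \<open>U\<close>.
\<close>

subsection \<open>Definable predicates on assignments\<close>

lemma tval_cong: "(\<And>v. v \<in> vars_tm t \<Longrightarrow> e v = e' v) \<Longrightarrow> tval M e t = tval M e' t"
proof (induction t)
  case (Fun f ts)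
  then have "map (tval M e) ts = map (tval M e') ts" by fastforce
  then show ?case by (simp only: tval.simps)
qed auto

lemma sat_cong: "(\<And>v. v \<in> fv \<phi> \<Longrightarrow> e v = e' v) \<Longrightarrow> sat M e \<phi> \<longleftrightarrow> sat M e' \<phi>"
proof (induction \<phi> arbitrary: e e')
  case (Eq s t)
  then have "tval M e s = tval M e' s" "tval M e t = tval M e' t"
    by (auto intro: tval_cong)
  then show ?case by simp
next
  case (Pred r ts)
  then have "map (tval M e) ts = map (tval M e') ts"
    by (auto intro!: tval_cong)
  then show ?case by (simp only: sat.simps)
next
  case (Exists v \<phi>)
  have "sat M (e(v := a)) \<phi> = sat M (e'(v := a)) \<phi>" for a
    by (rule Exists.IH) (use Exists.prems in auto)
  then show ?case by simp
next
  case (Neg \<phi>)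
  from Neg.IH[of e e'] Neg.prems show ?case by simp
next
  case (Conj \<phi> \<psi>)
  from Conj.IH(1)[of e e'] Conj.IH(2)[of e e'] Conj.prems show ?case by simp
qed

lemma finite_vars_tm: "finite (vars_tm t)"
  by (induction t) auto

lemma finite_fv: "finite (fv \<phi>)"
  by (induction \<phi>) (auto simp: finite_vars_tm)

lemma sat_foldr_Exists:
  assumes "range e \<subseteq> univ M"
  shows "sat M e (foldr Exists vs \<phi>) \<longleftrightarrow>
    (\<exists>e'. range e' \<subseteq> univ M \<and> (\<forall>v. v \<notin> set vs \<longrightarrow> e' v = e v) \<and> sat M e' \<phi>)"
  using assms
proof (induction vs arbitrary: e)
  case Nil
  have "e' = e" if "\<forall>v. e' v = e v" for e' using that by auto
  then show ?case using Nil by auto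
next
  case (Cons x vs)
  have r: "range (e(x := a)) \<subseteq> univ M" if "a \<in> univ M" for a
    using that Cons.prems by auto
  have "sat M e (foldr Exists (x # vs) \<phi>) \<longleftrightarrow> (\<exists>a\<in>univ M. \<exists>e'. range e' \<subseteq> univ M \<and>
      (\<forall>v. v \<notin> set vs \<longrightarrow> e' v = (e(x := a)) v) \<and> sat M e' \<phi>)"
    using Cons.IH[OF r] by (simp del: fun_upd_apply)
  also have "\<dots> \<longleftrightarrow> (\<exists>e'. range e' \<subseteq> univ M \<and>
      (\<forall>v. v \<notin> set (x # vs) \<longrightarrow> e' v = e v) \<and> sat M e' \<phi>)"
  proof
    assume "\<exists>e'. range e' \<subseteq> univ M \<and> (\<forall>v. v \<notin> set (x # vs) \<longrightarrow> e' v = e v) \<and> sat M e' \<phi>"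
    then obtain e' where e': "range e' \<subseteq> univ M" "\<forall>v. v \<notin> set (x # vs) \<longrightarrow> e' v = e v"
      "sat M e' \<phi>" by auto
    show "\<exists>a\<in>univ M. \<exists>e'. range e' \<subseteq> univ M \<and>
      (\<forall>v. v \<notin> set vs \<longrightarrow> e' v = (e(x := a)) v) \<and> sat M e' \<phi>"
      by (rule bexI[of _ "e' x"], rule exI[of _ e']) (use e' in auto)
  next
    assume "\<exists>a\<in>univ M. \<exists>e'. range e' \<subseteq> univ M \<and>
      (\<forall>v. v \<notin> set vs \<longrightarrow> e' v = (e(x := a)) v) \<and> sat M e' \<phi>"
    then obtain a e' where "range e' \<subseteq> univ M" "\<forall>v. v \<notin> set vs \<longrightarrow> e' v = (e(x := a)) v"
      "sat M e' \<phi>" by blast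
    then show "\<exists>e'. range e' \<subseteq> univ M \<and> (\<forall>v. v \<notin> set (x # vs) \<longrightarrow> e' v = e v) \<and> sat M e' \<phi>"
      by (intro exI[of _ e']) auto
  qed
  finally show ?case .
qed

lemma fv_foldr_Exists: "fv (foldr Exists vs \<phi>) = fv \<phi> - set vs"
  by (induction vs) auto

lemma formulas_foldr_Exists: "foldr Exists vs \<phi> \<in> formulas L \<longleftrightarrow> \<phi> \<in> formulas L"
  by (induction vs) (auto simp: formulas_def)

text \<open>A semantic substitute for formulas, so that substitution and quantification can be
  handled without touching syntax. \<open>F\<close> bounds the free variables; agreement is asked
  for assignments with values in the universe, where quantifiers range.\<close>

definition definable ::
  "('f, 'r) lang \<Rightarrow> ('f, 'r, 'm) struct \<Rightarrow> nat set \<Rightarrow> ((nat \<Rightarrow> 'm) \<Rightarrow> bool) \<Rightarrow> bool" where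
  "definable L M F R \<longleftrightarrow>
     (\<exists>\<phi>\<in>formulas L. fv \<phi> \<subseteq> F \<and> (\<forall>e. range e \<subseteq> univ M \<longrightarrow> (sat M e \<phi> \<longleftrightarrow> R e)))"

lemma definable_finite_support:
  assumes "definable L M F R"
  obtains F' where "finite F'" "F' \<subseteq> F" "definable L M F' R"
  using assms unfolding definable_def by (metis finite_fv order_refl)

lemma definable_mono: "definable L M F R \<Longrightarrow> F \<subseteq> F' \<Longrightarrow> definable L M F' R"
  unfolding definable_def by (meson order_trans)

lemma definable_cong:
  "definable L M F R \<Longrightarrow> (\<And>e. range e \<subseteq> univ M \<Longrightarrow> R e \<longleftrightarrow> R' e) \<Longrightarrow> definable L M F R'"
  unfolding definable_def by simp

lemma definable_agree:
  assumes "definable L M F R" "range e \<subseteq> univ M" "range e' \<subseteq> univ M" "\<And>v. v \<in> F \<Longrightarrow> e v = e' v"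
  shows "R e \<longleftrightarrow> R e'"
  using assms unfolding definable_def by (metis sat_cong subsetD)

lemma definable_eq: "v \<in> F \<Longrightarrow> w \<in> F \<Longrightarrow> definable L M F (\<lambda>e. e v = e w)"
  unfolding definable_def by (rule bexI[of _ "Eq (Var v) (Var w)"]) (auto simp: formulas_def)

lemma definable_not:
  assumes "definable L M F R"
  shows "definable L M F (\<lambda>e. \<not> R e)"
proof -
  obtain \<phi> where "\<phi> \<in> formulas L" "fv \<phi> \<subseteq> F" "\<forall>e. range e \<subseteq> univ M \<longrightarrow> (sat M e \<phi> \<longleftrightarrow> R e)"
    using assms unfolding definable_def by auto
  then show ?thesis
    unfolding definable_def by (intro bexI[of _ "Neg \<phi>"]) (auto simp: formulas_def)
qed

lemma definable_conj:
  assumes "definable L M F R" "definable L M F R'"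
  shows "definable L M F (\<lambda>e. R e \<and> R' e)"
proof -
  obtain \<phi> \<phi>' where "\<phi> \<in> formulas L" "fv \<phi> \<subseteq> F" "\<forall>e. range e \<subseteq> univ M \<longrightarrow> (sat M e \<phi> \<longleftrightarrow> R e)"
    "\<phi>' \<in> formulas L" "fv \<phi>' \<subseteq> F" "\<forall>e. range e \<subseteq> univ M \<longrightarrow> (sat M e \<phi>' \<longleftrightarrow> R' e)"
    using assms unfolding definable_def by auto
  then show ?thesis
    unfolding definable_def by (intro bexI[of _ "Conj \<phi> \<phi>'"]) (auto simp: formulas_def)
qed

lemma definable_True:
  assumes "univ M \<noteq> {}"
  shows "definable L M F (\<lambda>e. True)"
  unfolding definable_def
  by (rule bexI[of _ "Exists 0 (Eq (Var 0) (Var 0))"]) (use assms in \<open>auto simp: formulas_def\<close>)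

lemma definable_ball:
  assumes "univ M \<noteq> {}" "finite I" "\<And>i. i \<in> I \<Longrightarrow> definable L M F (R i)"
  shows "definable L M F (\<lambda>e. \<forall>i\<in>I. R i e)"
  using assms(2,3)
  by (induction I rule: finite_induct) (auto intro: definable_True[OF assms(1)] definable_conj)

text \<open>Quantifying over whole assignments stays first order, because only the finitely many
  free variables outside \<open>G\<close> matter and these can be bound one by one.\<close>

lemma definable_ex_agree:
  assumes "definable L M F R"
  shows "definable L M (F \<inter> G)
    (\<lambda>e. \<exists>e'. range e' \<subseteq> univ M \<and> (\<forall>v\<in>G. e' v = e v) \<and> R e')"
proof -
  obtain \<phi> where \<phi>: "\<phi> \<in> formulas L" "fv \<phi> \<subseteq> F"
    "\<And>e. range e \<subseteq> univ M \<Longrightarrow> (sat M e \<phi> \<longleftrightarrow> R e)"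
    using assms unfolding definable_def by auto
  define vs where "vs = sorted_list_of_set (fv \<phi> - G)"
  have vs: "set vs = fv \<phi> - G" by (simp add: vs_def finite_fv)
  have "sat M e (foldr Exists vs \<phi>) \<longleftrightarrow>
      (\<exists>e'. range e' \<subseteq> univ M \<and> (\<forall>v\<in>G. e' v = e v) \<and> R e')" if e: "range e \<subseteq> univ M" for e
    unfolding sat_foldr_Exists[OF e]
  proof
    assume "\<exists>e'. range e' \<subseteq> univ M \<and> (\<forall>v. v \<notin> set vs \<longrightarrow> e' v = e v) \<and> sat M e' \<phi>"
    then show "\<exists>e'. range e' \<subseteq> univ M \<and> (\<forall>v\<in>G. e' v = e v) \<and> R e'"
      using \<phi>(3) vs by blast
  next
    assume "\<exists>e'. range e' \<subseteq> univ M \<and> (\<forall>v\<in>G. e' v = e v) \<and> R e'"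
    then obtain e' where e': "range e' \<subseteq> univ M" "\<forall>v\<in>G. e' v = e v" "R e'" by auto
    \<comment> \<open>\<open>e'\<close> may differ from \<open>e\<close> at variables that do not
      occur in \<open>\<phi>\<close>; the patched assignment differs from \<open>e\<close> at bound
      variables only.\<close>
    let ?e = "\<lambda>v. if v \<in> set vs then e' v else e v"
    have "sat M ?e \<phi> \<longleftrightarrow> sat M e' \<phi>"
      by (rule sat_cong) (use vs e' in auto)
    then show "\<exists>e'. range e' \<subseteq> univ M \<and> (\<forall>v. v \<notin> set vs \<longrightarrow> e' v = e v) \<and> sat M e' \<phi>"
      using e e' \<phi>(3)[OF e'(1)] by (intro exI[of _ ?e]) auto
  qed
  then show ?thesis
    unfolding definable_def using \<phi> vs
    by (intro bexI[of _ "foldr Exists vs \<phi>"]) (auto simp: fv_foldr_Exists formulas_foldr_Exists)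
qed

text \<open>Substitution is expressed by quantification: the variables in \<open>F\<close> are bound
  and required to equal their images under \<open>\<sigma>\<close>. Disjointness keeps the images
  free.\<close>

lemma definable_rename_disjoint:
  assumes ne: "univ M \<noteq> {}" and R: "definable L M F R" and "finite F" and disj: "\<sigma> ` F \<inter> F = {}"
  shows "definable L M (\<sigma> ` F) (\<lambda>e. R (\<lambda>v. e (\<sigma> v)))"
proof -
  have "definable L M (F \<union> \<sigma> ` F) (\<lambda>e. (\<forall>v\<in>F. e v = e (\<sigma> v)) \<and> R e)"
    by (intro definable_conj definable_ball definable_eq ne definable_mono[OF R] \<open>finite F\<close>) auto
  from definable_ex_agree[OF this, of "- F"]
  have *: "definable L M ((F \<union> \<sigma> ` F) \<inter> - F)
    (\<lambda>e. \<exists>e'. range e' \<subseteq> univ M \<and> (\<forall>v\<in>- F. e' v = e v) \<and> (\<forall>v\<in>F. e' v = e' (\<sigma> v)) \<and> R e')" .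
  have iff: "(\<exists>e'. range e' \<subseteq> univ M \<and> (\<forall>v\<in>- F. e' v = e v) \<and> (\<forall>v\<in>F. e' v = e' (\<sigma> v)) \<and> R e')
     \<longleftrightarrow> R (\<lambda>v. e (\<sigma> v))" if e: "range e \<subseteq> univ M" for e
  proof
    assume "R (\<lambda>v. e (\<sigma> v))"
    let ?e = "\<lambda>v. if v \<in> F then e (\<sigma> v) else e v"
    have "R ?e \<longleftrightarrow> R (\<lambda>v. e (\<sigma> v))"
      by (rule definable_agree[OF R]) (use e in auto)
    then show "\<exists>e'. range e' \<subseteq> univ M \<and> (\<forall>v\<in>- F. e' v = e v) \<and> (\<forall>v\<in>F. e' v = e' (\<sigma> v)) \<and> R e'"
      using e disj \<open>R (\<lambda>v. e (\<sigma> v))\<close> by (intro exI[of _ ?e]) auto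
  next
    assume "\<exists>e'. range e' \<subseteq> univ M \<and> (\<forall>v\<in>- F. e' v = e v) \<and> (\<forall>v\<in>F. e' v = e' (\<sigma> v)) \<and> R e'"
    then obtain e' where e': "range e' \<subseteq> univ M" "\<forall>v\<in>- F. e' v = e v"
      "\<forall>v\<in>F. e' v = e' (\<sigma> v)" "R e'" by auto
    have "R e' \<longleftrightarrow> R (\<lambda>v. e (\<sigma> v))"
      by (rule definable_agree[OF R]) (use e e' disj in auto)
    then show "R (\<lambda>v. e (\<sigma> v))" using e' by simp
  qed
  have "definable L M ((F \<union> \<sigma> ` F) \<inter> - F) (\<lambda>e. R (\<lambda>v. e (\<sigma> v)))"
    by (rule definable_cong[OF *]) (rule iff)
  then show ?thesis by (rule definable_mono) auto
qed

lemma definable_rename: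
  assumes ne: "univ M \<noteq> {}" and R: "definable L M F R"
  shows "definable L M UNIV (\<lambda>e. R (\<lambda>v. e (\<sigma> v)))"
proof -
  obtain F where F: "finite F" and R: "definable L M F R"
    by (rule definable_finite_support[OF R])
  have "finite (F \<union> \<sigma> ` F)" using F by simp
  then obtain N where "\<forall>v\<in>F \<union> \<sigma> ` F. v < N"
    using finite_nat_set_iff_bounded by blast
  then have N: "\<And>v. v \<in> F \<Longrightarrow> v < N" "\<And>v. v \<in> F \<Longrightarrow> \<sigma> v < N" by auto
  \<comment> \<open>The detour through a fresh block of variables allows \<open>\<sigma> ` F\<close> to meet \<open>F\<close>.\<close>
  have 1: "definable L M ((\<lambda>v. v + N) ` F) (\<lambda>e. R (\<lambda>v. e (v + N)))"
  proof (rule definable_rename_disjoint[OF ne R F, where \<sigma> = "\<lambda>v. v + N"])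
    show "(\<lambda>v. v + N) ` F \<inter> F = {}" by (auto dest!: N(1))
  qed
  have "definable L M ((\<lambda>w. \<sigma> (w - N)) ` (\<lambda>v. v + N) ` F) (\<lambda>e. R (\<lambda>v. e (\<sigma> (v + N - N))))"
  proof (rule definable_rename_disjoint[OF ne 1, where \<sigma> = "\<lambda>w. \<sigma> (w - N)"])
    show "finite ((\<lambda>v. v + N) ` F)" using F by simp
    show "(\<lambda>w. \<sigma> (w - N)) ` (\<lambda>v. v + N) ` F \<inter> (\<lambda>v. v + N) ` F = {}"
      by (auto dest!: N(2))
  qed
  then have "definable L M ((\<lambda>w. \<sigma> (w - N)) ` (\<lambda>v. v + N) ` F) (\<lambda>e. R (\<lambda>v. e (\<sigma> v)))"
    by simp
  then show ?thesis by (rule definable_mono) simp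
qed

text \<open>Two assignments are interleaved in one, \<open>f\<close> on the even and
  \<open>e\<close> on the odd variables. Quantifying over the even variables and then renaming
  \<open>v\<close> to \<open>v div 2\<close> leaves \<open>e\<close> alone as the argument.\<close>

lemma definable_ex_assignment:
  fixes T :: "(nat \<Rightarrow> 'm) \<Rightarrow> (nat \<Rightarrow> 'm) \<Rightarrow> bool"
  assumes ne: "univ M \<noteq> {}" and T: "definable L M UNIV (\<lambda>e. T (\<lambda>n. e (2 * n)) (\<lambda>n. e (2 * n + 1)))"
  shows "definable L M UNIV (\<lambda>e. \<exists>f. range f \<subseteq> univ M \<and> T f e)"
proof -
  let ?P = "\<lambda>e. \<exists>e'. range e' \<subseteq> univ M \<and> (\<forall>v\<in>{v. odd v}. e' v = e v) \<and>
    T (\<lambda>n. e' (2 * n)) (\<lambda>n. e' (2 * n + 1))"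
  have "definable L M UNIV ?P"
    using definable_ex_agree[OF T, of "{v. odd v}"] by (rule definable_mono) auto
  from definable_rename[OF ne this, of "\<lambda>v. v div 2"]
  have P: "definable L M UNIV (\<lambda>e. ?P (\<lambda>v. e (v div 2)))" .
  have iff: "?P (\<lambda>v. e (v div 2)) \<longleftrightarrow> (\<exists>f. range f \<subseteq> univ M \<and> T f e)"
    if e: "range e \<subseteq> univ M" for e
  proof
    assume "?P (\<lambda>v. e (v div 2))"
    then obtain e' where e': "range e' \<subseteq> univ M" "\<forall>v\<in>{v. odd v}. e' v = e (v div 2)"
      "T (\<lambda>n. e' (2 * n)) (\<lambda>n. e' (2 * n + 1))" by auto
    have "e' (2 * n + 1) = e n" for n using e'(2)[rule_format, of "2 * n + 1"] by simp
    then have "T (\<lambda>n. e' (2 * n)) e" using e'(3) by presburger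
    moreover have "range (\<lambda>n. e' (2 * n)) \<subseteq> univ M" using e'(1) by blast
    ultimately show "\<exists>f. range f \<subseteq> univ M \<and> T f e" by blast
  next
    assume "\<exists>f. range f \<subseteq> univ M \<and> T f e"
    then obtain f where f: "range f \<subseteq> univ M" "T f e" by auto
    let ?e = "\<lambda>v. if even v then f (v div 2) else e (v div 2)"
    have "range ?e \<subseteq> univ M" using e f(1) by auto
    moreover have "T (\<lambda>n. ?e (2 * n)) (\<lambda>n. ?e (2 * n + 1))" using f(2) by simp
    ultimately show "?P (\<lambda>v. e (v div 2))" by (intro exI[of _ ?e]) simp
  qed
  show ?thesis
  proof (rule definable_cong[OF P])
    fix e :: "nat \<Rightarrow> 'm" assume "range e \<subseteq> univ M"
    from iff[OF this] show "?P (\<lambda>v. e (v div 2)) \<longleftrightarrow> (\<exists>f. range f \<subseteq> univ M \<and> T f e)" .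
  qed
qed

subsection \<open>Compactness in a saturated structure\<close>

text \<open>Finite parameter sets are what the compactness argument meets, which fixes the values of
  the variables one after another.\<close>

definition finitely_saturated :: "('f, 'r) lang \<Rightarrow> ('f, 'r, 'm) struct \<Rightarrow> bool" where
  "finitely_saturated L M \<longleftrightarrow>
     univ M \<noteq> {} \<and>
     (\<forall>A \<Sigma> x. A \<subseteq> univ M \<and> finite A \<and> \<Sigma> \<subseteq> param_formulas L A [x] \<and> consistent M [x] \<Sigma>
        \<longrightarrow> (\<exists>b. realizes M [x] [b] \<Sigma>))"

lemma infinite_formulas:
  fixes L :: "('f, 'r) lang"
  shows "infinite (formulas L)"
proof
  let ?f = "\<lambda>n. Eq (Var n) (Var n) :: ('f, 'r) form"
  assume "finite (formulas L)"
  moreover have "range ?f \<subseteq> formulas L" by (auto simp: formulas_def)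
  ultimately have "finite (range ?f)" by (rule rev_finite_subset)
  moreover have "inj ?f" by (auto simp: inj_on_def)
  ultimately show False by (simp add: finite_image_iff)
qed

text \<open>A finite set is smaller than the infinite set of formulas, hence smaller than
  \<open>\<kappa>\<close>.\<close>

lemma monster_model_finitely_saturated:
  fixes M :: "('f, 'r, 'm) struct"
  assumes "monster_model L T \<kappa> M"
  shows "finitely_saturated L M"
proof -
  have \<kappa>: "|formulas L| <o \<kappa>" "saturated L \<kappa> M" "univ M \<noteq> {}"
    using assms unfolding monster_model_def is_model_def structure_of_def by auto
  have small: "|A| <o \<kappa>" if "finite A" for A :: "'m set"
  proof (rule ordLess_transitive[OF _ \<kappa>(1)])
    show "|A| <o |formulas L|"
      by (rule finite_ordLess_infinite) (use that infinite_formulas[of L] in \<open>simp_all add: Field_card_of card_of_well_order_on\<close>)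
  qed
  show ?thesis unfolding finitely_saturated_def
  proof (intro conjI allI impI \<kappa>(3))
    fix A :: "'m set" and \<Sigma> x
    assume "A \<subseteq> univ M \<and> finite A \<and> \<Sigma> \<subseteq> param_formulas L A [x] \<and> consistent M [x] \<Sigma>"
    then show "\<exists>b. realizes M [x] [b] \<Sigma>"
      using \<kappa>(2)[unfolded saturated_def, rule_format, of A \<Sigma> x] small[of A] by simp
  qed
qed

lemma assign_single: "assign e [x] [b] = e(x := b)"
  by (auto simp: assign_def)

text \<open>The invariant for building a solution of \<Gamma> variable by variable; the values below
  \<open>k\<close> have already been chosen.\<close>

definition fin_sat_over ::
  "('f, 'r, 'm) struct \<Rightarrow> ((nat \<Rightarrow> 'm) \<Rightarrow> bool) set \<Rightarrow> nat \<Rightarrow> (nat \<Rightarrow> 'm) \<Rightarrow> bool" where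
  "fin_sat_over M \<Gamma> k e \<longleftrightarrow> (\<forall>\<Gamma>\<^sub>0\<subseteq>\<Gamma>. finite \<Gamma>\<^sub>0 \<longrightarrow>
     (\<exists>e'. range e' \<subseteq> univ M \<and> (\<forall>v\<in>{..<k}. e' v = e v) \<and> (\<forall>R\<in>\<Gamma>\<^sub>0. R e')))"

lemma fin_sat_over_cong:
  "(\<And>v. v < k \<Longrightarrow> e v = e' v) \<Longrightarrow> fin_sat_over M \<Gamma> k e \<longleftrightarrow> fin_sat_over M \<Gamma> k e'"
  unfolding fin_sat_over_def by simp

text \<open>For each finite \<open>\<Gamma>\<^sub>0\<close>, that the values up to \<open>k\<close>
  extend to a solution is a formula in these variables. With the values below \<open>k\<close> as
  parameters these formulas form a type in the variable \<open>k\<close>, which saturation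
  realizes.\<close>

lemma fin_sat_over_step:
  assumes sat: "finitely_saturated L M" and \<Gamma>: "\<And>R. R \<in> \<Gamma> \<Longrightarrow> definable L M UNIV R"
    and e: "range e \<subseteq> univ M" and fin: "fin_sat_over M \<Gamma> k e"
  shows "\<exists>b\<in>univ M. fin_sat_over M \<Gamma> (Suc k) (e(k := b))"
proof -
  have ne: "univ M \<noteq> {}" using sat by (simp add: finitely_saturated_def)
  define Q where "Q \<Gamma>\<^sub>0 e = (\<exists>e'. range e' \<subseteq> univ M \<and> (\<forall>v\<in>{..<Suc k}. e' v = e v) \<and>
    (\<forall>R\<in>\<Gamma>\<^sub>0. R e'))" for \<Gamma>\<^sub>0 e
  have "definable L M {..<Suc k} (Q \<Gamma>\<^sub>0)" if "\<Gamma>\<^sub>0 \<subseteq> \<Gamma>" "finite \<Gamma>\<^sub>0" for \<Gamma>\<^sub>0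
  proof -
    have "definable L M UNIV (\<lambda>e. \<forall>R\<in>\<Gamma>\<^sub>0. R e)"
      by (rule definable_ball[OF ne]) (use that \<Gamma> in auto)
    from definable_ex_agree[OF this, of "{..<Suc k}"] show ?thesis
      unfolding Q_def by simp
  qed
  then obtain \<phi> where \<phi>: "\<And>\<Gamma>\<^sub>0. \<Gamma>\<^sub>0 \<subseteq> \<Gamma> \<Longrightarrow> finite \<Gamma>\<^sub>0 \<Longrightarrow> \<phi> \<Gamma>\<^sub>0 \<in> formulas L \<and> fv (\<phi> \<Gamma>\<^sub>0) \<subseteq> {..<Suc k} \<and>
      (\<forall>e. range e \<subseteq> univ M \<longrightarrow> (sat M e (\<phi> \<Gamma>\<^sub>0) \<longleftrightarrow> Q \<Gamma>\<^sub>0 e))"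
    unfolding definable_def by metis
  define \<Sigma> where "\<Sigma> = (\<lambda>\<Gamma>\<^sub>0. (\<phi> \<Gamma>\<^sub>0, e)) ` {\<Gamma>\<^sub>0. \<Gamma>\<^sub>0 \<subseteq> \<Gamma> \<and> finite \<Gamma>\<^sub>0}"
  have upd: "range (e(k := b)) \<subseteq> univ M" if "b \<in> univ M" for b using e that by auto
  have "\<Sigma> \<subseteq> param_formulas L (e ` {..<k}) [k]"
    unfolding \<Sigma>_def
  proof (rule image_subsetI)
    fix \<Gamma>\<^sub>0 assume "\<Gamma>\<^sub>0 \<in> {\<Gamma>\<^sub>0. \<Gamma>\<^sub>0 \<subseteq> \<Gamma> \<and> finite \<Gamma>\<^sub>0}"
    then have "\<phi> \<Gamma>\<^sub>0 \<in> formulas L" "fv (\<phi> \<Gamma>\<^sub>0) - set [k] \<subseteq> {..<k}"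
      using \<phi>[of \<Gamma>\<^sub>0] by (auto simp: lessThan_Suc)
    then show "(\<phi> \<Gamma>\<^sub>0, e) \<in> param_formulas L (e ` {..<k}) [k]"
      unfolding param_formulas_def by (simp add: image_mono)
  qed
  moreover have "consistent M [k] \<Sigma>"
    unfolding consistent_def
  proof (intro allI impI)
    fix \<Sigma>\<^sub>0 assume "\<Sigma>\<^sub>0 \<subseteq> \<Sigma>" "finite \<Sigma>\<^sub>0"
    then obtain C where C: "C \<subseteq> {\<Gamma>\<^sub>0. \<Gamma>\<^sub>0 \<subseteq> \<Gamma> \<and> finite \<Gamma>\<^sub>0}" "finite C" "\<Sigma>\<^sub>0 = (\<lambda>\<Gamma>\<^sub>0. (\<phi> \<Gamma>\<^sub>0, e)) ` C"
      unfolding \<Sigma>_def by (meson finite_subset_image)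
    \<comment> \<open>One solution of the union serves all members of \<open>C\<close> at once, so
      the type is finitely satisfiable.\<close>
    have "\<Union>C \<subseteq> \<Gamma>" "finite (\<Union>C)" using C by auto
    then obtain e' where e': "range e' \<subseteq> univ M" "\<forall>v\<in>{..<k}. e' v = e v" "\<forall>R\<in>\<Union>C. R e'"
      using fin unfolding fin_sat_over_def by meson
    have b: "e' k \<in> univ M" using e' by auto
    have "Q \<Gamma>\<^sub>0 (e(k := e' k))" if "\<Gamma>\<^sub>0 \<in> C" for \<Gamma>\<^sub>0
      unfolding Q_def using e' that by (intro exI[of _ e']) (auto simp: less_Suc_eq)
    then have "sat M (e(k := e' k)) (\<phi> \<Gamma>\<^sub>0)" if "\<Gamma>\<^sub>0 \<in> C" for \<Gamma>\<^sub>0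
      using C(1) \<phi>[of \<Gamma>\<^sub>0] upd[OF b] that by blast
    then have "realizes M [k] [e' k] \<Sigma>\<^sub>0"
      using C(3) b unfolding realizes_def by (simp add: assign_single tuples_def)
    then show "\<exists>bs. realizes M [k] bs \<Sigma>\<^sub>0" by blast
  qed
  moreover have "e ` {..<k} \<subseteq> univ M" "finite (e ` {..<k})" using e by auto
  ultimately obtain b where b: "realizes M [k] [b] \<Sigma>"
    using sat unfolding finitely_saturated_def by blast
  then have bM: "b \<in> univ M" by (auto simp: realizes_def tuples_def)
  have "Q \<Gamma>\<^sub>0 (e(k := b))" if "\<Gamma>\<^sub>0 \<subseteq> \<Gamma>" "finite \<Gamma>\<^sub>0" for \<Gamma>\<^sub>0
  proof -
    have "sat M (e(k := b)) (\<phi> \<Gamma>\<^sub>0)"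
      using b that unfolding realizes_def \<Sigma>_def by (simp add: assign_single)
    then show ?thesis using \<phi>[OF that] upd[OF bM] by blast
  qed
  then show ?thesis using bM unfolding fin_sat_over_def Q_def by blast
qed

text \<open>Each predicate depends on finitely many variables, so it is decided at a finite stage of
  a construction that fixes one more variable at each stage.\<close>

lemma compactness:
  assumes sat: "finitely_saturated L M" and \<Gamma>: "\<And>R. R \<in> \<Gamma> \<Longrightarrow> definable L M UNIV R"
    and fin: "\<And>\<Gamma>\<^sub>0. \<Gamma>\<^sub>0 \<subseteq> \<Gamma> \<Longrightarrow> finite \<Gamma>\<^sub>0 \<Longrightarrow> \<exists>e. range e \<subseteq> univ M \<and> (\<forall>R\<in>\<Gamma>\<^sub>0. R e)"
  shows "\<exists>e. range e \<subseteq> univ M \<and> (\<forall>R\<in>\<Gamma>. R e)"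
proof -
  obtain d where d: "d \<in> univ M" using sat by (auto simp: finitely_saturated_def)
  have "\<exists>E. \<forall>k. (range (E k) \<subseteq> univ M \<and> fin_sat_over M \<Gamma> k (E k)) \<and> (\<exists>b. E (Suc k) = (E k)(k := b))"
  proof (rule dependent_nat_choice)
    show "\<exists>e. range e \<subseteq> univ M \<and> fin_sat_over M \<Gamma> 0 e"
      by (rule exI[of _ "\<lambda>_. d"]) (use d fin in \<open>auto simp: fin_sat_over_def\<close>)
  next
    fix e k assume "range e \<subseteq> univ M \<and> fin_sat_over M \<Gamma> k e"
    moreover from this obtain b where "b \<in> univ M" "fin_sat_over M \<Gamma> (Suc k) (e(k := b))"
      using fin_sat_over_step[OF sat \<Gamma>] by blast
    ultimately show "\<exists>e'. (range e' \<subseteq> univ M \<and> fin_sat_over M \<Gamma> (Suc k) e') \<and> (\<exists>b. e' = e(k := b))"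
      by (intro exI[of _ "e(k := b)"]) auto
  qed
  then obtain E where E: "\<And>k. range (E k) \<subseteq> univ M" "\<And>k. fin_sat_over M \<Gamma> k (E k)"
    "\<And>k. \<exists>b. E (Suc k) = (E k)(k := b)" by blast
  have stable: "E k v = E (Suc v) v" if "v < k" for k v
    using that
  proof (induction k)
    case (Suc k)
    then show ?case using E(3)[of k] by (cases "v = k") auto
  qed simp
  \<comment> \<open>Variable \<open>v\<close> receives its final value at stage
    \<open>Suc v\<close>.\<close>
  define e where "e v = E (Suc v) v" for v
  have range: "range e \<subseteq> univ M" using E(1) by (auto simp: e_def)
  have fin: "fin_sat_over M \<Gamma> k e" for k
  proof -
    have "e v = E k v" if "v < k" for v using stable[OF that] by (simp only: e_def)
    then show ?thesis using fin_sat_over_cong[of k e "E k" M \<Gamma>] E(2)[of k] by blast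
  qed
  have "R e" if R: "R \<in> \<Gamma>" for R
  proof -
    obtain F where F: "finite F" "definable L M F R"
      by (rule definable_finite_support[OF \<Gamma>[OF R]])
    obtain k where k: "F \<subseteq> {..<k}" using F(1) finite_nat_iff_bounded by blast
    have "\<exists>e'. range e' \<subseteq> univ M \<and> (\<forall>v\<in>{..<k}. e' v = e v) \<and> (\<forall>R\<in>{R}. R e')"
      using fin[of k, unfolded fin_sat_over_def, rule_format, of "{R}"] R by blast
    then obtain e' where e': "range e' \<subseteq> univ M" "\<forall>v\<in>{..<k}. e' v = e v" "R e'" by auto
    have "e v = e' v" if "v \<in> F" for v using that k e'(2) by fastforce
    from definable_agree[OF F(2) range e'(1) this] show "R e" using e'(3) by blast
  qed
  then show ?thesis using range by blast
qed

subsection \<open>The antichain tree property for definable predicates\<close>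

text \<open>An element of \<open>P\<close> is a parameter tuple padded to a total assignment;
  \<open>f\<close> supplies the common values of the object variables \<open>X\<close>. This is
  outright realization, which for finite \<open>P\<close> amounts to consistency.\<close>

definition consist ::
  "('f, 'r, 'm) struct \<Rightarrow> ((nat \<Rightarrow> 'm) \<Rightarrow> bool) \<Rightarrow> nat set \<Rightarrow> (nat \<Rightarrow> 'm) set \<Rightarrow> bool" where
  "consist M R X P \<longleftrightarrow> (\<exists>f. range f \<subseteq> univ M \<and> (\<forall>p\<in>P. R (override_on p f X)))"

text \<open>The domain \<open>D\<close> allows trees of finite height, from which compactness
  produces the whole tree. Antichains are taken finite because consistency concerns finite
  subsets.\<close>

definition antichain_tree ::
  "('f, 'r, 'm) struct \<Rightarrow> ((nat \<Rightarrow> 'm) \<Rightarrow> bool) \<Rightarrow> nat set \<Rightarrow> bool list set \<Rightarrow>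
    (bool list \<Rightarrow> nat \<Rightarrow> 'm) \<Rightarrow> bool" where
  "antichain_tree M R X D a \<longleftrightarrow>
     (\<forall>\<eta>\<in>D. range (a \<eta>) \<subseteq> univ M) \<and>
     (\<forall>Z\<subseteq>D. finite Z \<and> antichain Z \<longrightarrow> consist M R X (a ` Z)) \<and>
     (\<forall>\<eta>\<in>D. \<forall>\<nu>\<in>D. strict_prefix \<eta> \<nu> \<longrightarrow> \<not> consist M R X {a \<eta>, a \<nu>})"

lemma consist_mono: "consist M R X P \<Longrightarrow> P' \<subseteq> P \<Longrightarrow> consist M R X P'"
  unfolding consist_def by blast

text \<open>\<open>\<rho> k v\<close> is the variable that stores entry \<open>v\<close> of the
  parameter assignment \<open>k\<close>, so one assignment holds finitely many parameter tuples. In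
  the proof object variables go to even places and stored parameters to odd ones, ready for
  \<open>definable_ex_assignment\<close>.\<close>

lemma definable_consist:
  fixes M :: "('f, 'r, 'm) struct"
  assumes ne: "univ M \<noteq> {}" and R: "definable L M UNIV R" and K: "finite K"
  shows "definable L M UNIV (\<lambda>e. consist M R X ((\<lambda>k v. e (\<rho> k v)) ` K))"
proof -
  have "definable L M UNIV (\<lambda>e. \<forall>k\<in>K. R (\<lambda>v. e (if v \<in> X then 2 * v else 2 * \<rho> k v + 1)))"
    by (rule definable_ball[OF ne K], rule definable_rename[OF ne R])
  moreover have "override_on (\<lambda>v. e (2 * \<rho> k v + 1)) (\<lambda>n. e (2 * n)) X =
      (\<lambda>v. e (if v \<in> X then 2 * v else 2 * \<rho> k v + 1))" for e :: "nat \<Rightarrow> 'm" and k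
    by (auto simp: override_on_def)
  ultimately have "definable L M UNIV (\<lambda>e. (\<lambda>f e. \<forall>k\<in>K. R (override_on (\<lambda>v. e (\<rho> k v)) f X))
      (\<lambda>n. e (2 * n)) (\<lambda>n. e (2 * n + 1)))"
    by simp
  from definable_ex_assignment[OF ne this] show ?thesis
    by (simp add: consist_def image_iff)
qed

text \<open>A tree of parameters is one assignment, with entry \<open>v\<close> at node \<eta>
  stored in variable \<open>to_nat (\<eta>, v)\<close>. Being an antichain tree then becomes a set
  of definable conditions, each about finitely many nodes, to which compactness applies.\<close>

lemma antichain_tree_compact:
  fixes M :: "('f, 'r, 'm) struct"
  assumes sat: "finitely_saturated L M" and R: "definable L M UNIV R"
    and fin: "\<And>m. \<exists>a. antichain_tree M R X {\<eta>. length \<eta> < m} a"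
  shows "\<exists>a. antichain_tree M R X UNIV a"
proof -
  have ne: "univ M \<noteq> {}" using sat by (simp add: finitely_saturated_def)
  then obtain d where d: "d \<in> univ M" by auto
  define C where "C Z e = consist M R X ((\<lambda>\<eta> v. e (to_nat (\<eta>, v))) ` Z)"
    for Z :: "bool list set" and e
  define \<Gamma> where "\<Gamma> = C ` {Z. finite Z \<and> antichain Z} \<union>
    (\<lambda>(\<eta>, \<nu>) e. \<not> C {\<eta>, \<nu>} e) ` {(\<eta>, \<nu>). strict_prefix \<eta> \<nu>}"
  have "\<exists>e. range e \<subseteq> univ M \<and> (\<forall>Q\<in>\<Gamma>. Q e)"
  proof (rule compactness[OF sat])
    have "definable L M UNIV (C Z)" if "finite Z" for Z
      unfolding C_def by (rule definable_consist[OF ne R that])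
    then show "definable L M UNIV Q" if "Q \<in> \<Gamma>" for Q
      using that unfolding \<Gamma>_def by (auto intro!: definable_not)
  next
    fix \<Gamma>\<^sub>0 assume \<Gamma>\<^sub>0: "\<Gamma>\<^sub>0 \<subseteq> \<Gamma>" "finite \<Gamma>\<^sub>0"
    \<comment> \<open>\<open>code m a\<close> stores a tree of height \<open>m\<close>; the default
      \<open>d\<close> fills the nodes beyond that height.\<close>
    define code where "code m a i = (case from_nat i of (\<eta>, v) \<Rightarrow>
      if length \<eta> < m then a \<eta> v else d)" for m :: nat and a :: "bool list \<Rightarrow> nat \<Rightarrow> 'm" and i
    have C: "C Z (code m a) \<longleftrightarrow> consist M R X (a ` Z)" if "\<And>\<eta>. \<eta> \<in> Z \<Longrightarrow> length \<eta> < m" for Z m a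
    proof -
      have "(\<lambda>\<eta> v. code m a (to_nat (\<eta>, v))) ` Z = a ` Z"
        by (rule image_cong) (use that in \<open>auto simp: code_def\<close>)
      then show ?thesis by (simp only: C_def)
    qed
    \<comment> \<open>Each condition speaks about nodes of bounded length and so holds for all high
      enough trees; finitely many conditions have a common height.\<close>
    have "\<forall>\<^sub>F m in sequentially. \<forall>a. antichain_tree M R X {\<eta>. length \<eta> < m} a \<longrightarrow> Q (code m a)"
      if "Q \<in> \<Gamma>\<^sub>0" for Q
    proof -
      have "Q \<in> \<Gamma>" using that \<Gamma>\<^sub>0 by blast
      then consider Z where "finite Z" "antichain Z" "Q = C Z"
        | \<eta> \<nu> where "strict_prefix \<eta> \<nu>" "Q = (\<lambda>e. \<not> C {\<eta>, \<nu>} e)"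
        unfolding \<Gamma>_def by auto
      then show ?thesis
      proof cases
        case 1
        have "\<forall>\<^sub>F m in sequentially. \<forall>\<eta>\<in>Z. length \<eta> < m"
          using 1 by (intro eventually_ball_finite ballI eventually_gt_at_top)
        then show ?thesis
        proof eventually_elim
          case (elim m)
          then have "C Z (code m a) \<longleftrightarrow> consist M R X (a ` Z)" for a by (intro C) auto
          moreover have "Z \<subseteq> {\<eta>. length \<eta> < m}" using elim by auto
          ultimately show ?case using 1 by (simp add: antichain_tree_def)
        qed
      next
        case 2
        have "\<forall>\<^sub>F m in sequentially. length \<nu> < m" by (rule eventually_gt_at_top)
        then show ?thesis
        proof eventually_elim
          case (elim m)
          then have len: "length \<eta> < m" "length \<nu> < m"
            using 2(1) by (meson less_trans prefix_length_less)+
          then have "C {\<eta>, \<nu>} (code m a) \<longleftrightarrow> consist M R X (a ` {\<eta>, \<nu>})" for a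
            by (intro C) auto
          then show ?case using len 2 by (simp add: antichain_tree_def)
        qed
      qed
    qed
    then have "\<forall>\<^sub>F m in sequentially. \<forall>Q\<in>\<Gamma>\<^sub>0. \<forall>a.
        antichain_tree M R X {\<eta>. length \<eta> < m} a \<longrightarrow> Q (code m a)"
      by (intro eventually_ball_finite[OF \<Gamma>\<^sub>0(2)] ballI)
    then obtain m where m: "\<And>Q a. Q \<in> \<Gamma>\<^sub>0 \<Longrightarrow> antichain_tree M R X {\<eta>. length \<eta> < m} a \<Longrightarrow> Q (code m a)"
      by (auto simp: eventually_sequentially)
    obtain a where a: "antichain_tree M R X {\<eta>. length \<eta> < m} a" using fin by blast
    then have "\<forall>\<eta>. length \<eta> < m \<longrightarrow> range (a \<eta>) \<subseteq> univ M"
      by (simp add: antichain_tree_def)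
    then have "a \<eta> v \<in> univ M" if "length \<eta> < m" for \<eta> v
      using that by blast
    then have "range (code m a) \<subseteq> univ M"
      using d by (auto simp: code_def split: prod.split)
    then show "\<exists>e. range e \<subseteq> univ M \<and> (\<forall>Q\<in>\<Gamma>\<^sub>0. Q e)" using m a by blast
  qed
  then obtain e where e: "range e \<subseteq> univ M" "\<And>Q. Q \<in> \<Gamma> \<Longrightarrow> Q e" by blast
  define a where "a \<eta> v = e (to_nat (\<eta>, v))" for \<eta> :: "bool list" and v :: nat
  have a: "consist M R X (a ` Z) \<longleftrightarrow> C Z e" for Z
    by (simp add: C_def a_def[abs_def])
  have "antichain_tree M R X UNIV a"
    unfolding antichain_tree_def
  proof (intro conjI ballI allI impI)
    show "range (a \<eta>) \<subseteq> univ M" for \<eta> using e(1) by (auto simp: a_def)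
    show "consist M R X (a ` Z)" if "finite Z \<and> antichain Z" for Z
      using e(2)[of "C Z"] that unfolding a \<Gamma>_def by blast
    show "\<not> consist M R X {a \<eta>, a \<nu>}" if "strict_prefix \<eta> \<nu>" for \<eta> \<nu>
    proof -
      have "(\<lambda>e. \<not> C {\<eta>, \<nu>} e) \<in> \<Gamma>" unfolding \<Gamma>_def using that by force
      from e(2)[OF this] show ?thesis using a[of "{\<eta>, \<nu>}"] by simp
    qed
  qed
  then show ?thesis by blast
qed

section \<open>Passage between parameter tuples and padded assignments\<close>

lemma assign_nth:
  assumes "length as = length vs" "v \<in> set vs"
  shows "assign e vs as v = assign e' vs as v" "assign e vs as v \<in> set as"
proof -
  obtain b where "map_of (zip vs as) v = Some b"
    using assms by (metis map_of_zip_is_Some)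
  then show "assign e vs as v = assign e' vs as v" "assign e vs as v \<in> set as"
    by (auto simp: assign_def dest: map_of_SomeD set_zip_rightD)
qed

lemma assign_other: "v \<notin> set vs \<Longrightarrow> assign e vs as v = e v"
  by (auto simp: assign_def split: option.split dest: map_of_SomeD set_zip_leftD)

lemma assign_map: "assign e vs (map f vs) = override_on e f (set vs)"
  by (auto simp: assign_def override_on_def map_of_zip_map)

lemma range_assign:
  assumes "length as = length vs" "range e \<subseteq> A" "set as \<subseteq> A"
  shows "range (assign e vs as) \<subseteq> A"
proof (rule image_subsetI)
  fix v show "assign e vs as v \<in> A"
    using assms assign_nth(2)[OF assms(1), of v e] assign_other[of v vs e as]
    by (cases "v \<in> set vs") auto
qed

lemma antichain_tree_of_witnesses_ATP:
  assumes "univ M \<noteq> {}" and \<phi>: "witnesses_ATP L M \<phi> xs ys"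
  shows "\<exists>a. antichain_tree M (\<lambda>e. sat M e \<phi>) (set xs) UNIV a"
proof -
  obtain d where d: "d \<in> univ M" using assms by auto
  from \<phi> obtain a where fv: "fv \<phi> \<subseteq> set (xs @ ys)" "distinct (xs @ ys)"
    and a: "\<forall>\<eta>. a \<eta> \<in> tuples M (length ys)"
      "\<forall>X. antichain X \<longrightarrow> consistent M xs {instance_of \<phi> ys (a \<eta>) | \<eta>. \<eta> \<in> X}"
      "\<forall>\<eta> \<nu>. prefix \<eta> \<nu> \<and> \<eta> \<noteq> \<nu> \<longrightarrow>
           \<not> consistent M xs {instance_of \<phi> ys (a \<eta>), instance_of \<phi> ys (a \<nu>)}"
    unfolding witnesses_ATP_def by (elim conjE exE) (rule that; assumption)
  note a = a[rule_format]
  \<comment> \<open>Padding with \<open>d\<close> in place of \<open>undefined\<close> keeps the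
    values inside the universe; the instances see only the values at \<open>ys\<close>, since the
    free variables of \<phi> lie in \<open>xs\<close> and \<open>ys\<close>.\<close>
  define b where "b \<eta> = assign (\<lambda>_. d) ys (a \<eta>)" for \<eta>
  have len: "length (a \<eta>) = length ys" "set (a \<eta>) \<subseteq> univ M" for \<eta>
    using a(1) by (auto simp: tuples_def)
  have b: "range (b \<eta>) \<subseteq> univ M" for \<eta>
    unfolding b_def using d len by (intro range_assign) auto
  have sat_b: "sat M (assign (assign (\<lambda>_. undefined) ys (a \<eta>)) xs bs) \<phi> \<longleftrightarrow>
      sat M (assign (b \<eta>) xs bs) \<phi>" if "length bs = length xs" for \<eta> bs
  proof (rule sat_cong)
    fix v assume "v \<in> fv \<phi>"
    then show "assign (assign (\<lambda>_. undefined) ys (a \<eta>)) xs bs v = assign (b \<eta>) xs bs v"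
      using fv that by (cases "v \<in> set xs")
        (auto simp: b_def assign_other intro: assign_nth(1) len)
  qed
  have iff: "consistent M xs {instance_of \<phi> ys (a \<eta>) | \<eta>. \<eta> \<in> Z} \<longleftrightarrow>
      consist M (\<lambda>e. sat M e \<phi>) (set xs) (b ` Z)" if fin: "finite Z" for Z
  proof
    assume con: "consistent M xs {instance_of \<phi> ys (a \<eta>) | \<eta>. \<eta> \<in> Z}"
    have "finite {instance_of \<phi> ys (a \<eta>) | \<eta>. \<eta> \<in> Z}"
      using fin by (simp add: setcompr_eq_image)
    from con[unfolded consistent_def, rule_format, OF subset_refl this]
    obtain bs where bs: "realizes M xs bs {instance_of \<phi> ys (a \<eta>) | \<eta>. \<eta> \<in> Z}" ..
    then have l: "length bs = length xs" "set bs \<subseteq> univ M" by (auto simp: realizes_def tuples_def)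
    let ?f = "assign (\<lambda>_. d) xs bs"
    have eq: "override_on (b \<eta>) ?f (set xs) = assign (b \<eta>) xs bs" for \<eta>
    proof
      show "override_on (b \<eta>) ?f (set xs) v = assign (b \<eta>) xs bs v" for v
        using assign_nth(1)[OF l(1), of v "\<lambda>_. d" "b \<eta>"] assign_other[of v xs "b \<eta>" bs]
        by (cases "v \<in> set xs") auto
    qed
    have "sat M (override_on (b \<eta>) ?f (set xs)) \<phi>" if "\<eta> \<in> Z" for \<eta>
    proof -
      have "instance_of \<phi> ys (a \<eta>) \<in> {instance_of \<phi> ys (a \<eta>) | \<eta>. \<eta> \<in> Z}" using that by blast
      then have "sat M (assign (assign (\<lambda>_. undefined) ys (a \<eta>)) xs bs) \<phi>"
        using bs unfolding realizes_def instance_of_def by blast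
      then show ?thesis using sat_b[OF l(1)] eq by simp
    qed
    moreover have "range ?f \<subseteq> univ M" using l d by (intro range_assign) auto
    ultimately show "consist M (\<lambda>e. sat M e \<phi>) (set xs) (b ` Z)"
      unfolding consist_def by blast
  next
    assume "consist M (\<lambda>e. sat M e \<phi>) (set xs) (b ` Z)"
    then obtain f where f: "range f \<subseteq> univ M" "\<And>\<eta>. \<eta> \<in> Z \<Longrightarrow> sat M (override_on (b \<eta>) f (set xs)) \<phi>"
      unfolding consist_def by auto
    have "realizes M xs (map f xs) \<Sigma>\<^sub>0" if "\<Sigma>\<^sub>0 \<subseteq> {instance_of \<phi> ys (a \<eta>) | \<eta>. \<eta> \<in> Z}" for \<Sigma>\<^sub>0
    proof -
      have "sat M (assign e xs (map f xs)) \<psi>" if "(\<psi>, e) \<in> \<Sigma>\<^sub>0" for \<psi> e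
      proof -
        obtain \<eta> where "\<eta> \<in> Z" "\<psi> = \<phi>" "e = assign (\<lambda>_. undefined) ys (a \<eta>)"
          using \<open>(\<psi>, e) \<in> \<Sigma>\<^sub>0\<close> \<open>\<Sigma>\<^sub>0 \<subseteq> _\<close> unfolding instance_of_def by blast
        then show ?thesis using f(2)[of \<eta>] sat_b[of "map f xs" \<eta>] by (simp add: assign_map)
      qed
      then show ?thesis using f(1) unfolding realizes_def tuples_def by auto
    qed
    then show "consistent M xs {instance_of \<phi> ys (a \<eta>) | \<eta>. \<eta> \<in> Z}"
      unfolding consistent_def by blast
  qed
  have "antichain_tree M (\<lambda>e. sat M e \<phi>) (set xs) UNIV b"
    unfolding antichain_tree_def
  proof (intro conjI ballI allI impI)
    show "range (b \<eta>) \<subseteq> univ M" for \<eta> by (rule b)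
    show "consist M (\<lambda>e. sat M e \<phi>) (set xs) (b ` Z)" if "finite Z \<and> antichain Z" for Z
      using that iff[of Z] a(2)[of Z] by simp
    show "\<not> consist M (\<lambda>e. sat M e \<phi>) (set xs) {b \<eta>, b \<nu>}" if "strict_prefix \<eta> \<nu>" for \<eta> \<nu>
      using iff[of "{\<eta>, \<nu>}", unfolded setcompr_eq_image Collect_mem_eq] a(3)[of \<eta> \<nu>] that
      by (simp add: strict_prefix_def)
  qed
  then show ?thesis by blast
qed

text \<open>A defining formula has finitely many free variables; listing those other than
  \<open>x\<close> as \<open>zs\<close> turns the assignments of the tree into parameter
  tuples.\<close>

lemma witnesses_ATP_of_antichain_tree:
  assumes "definable L M UNIV R" and "antichain_tree M R {x} UNIV a"
  shows "\<exists>\<psi> zs. witnesses_ATP L M \<psi> [x] zs"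
proof -
  obtain \<psi> where \<psi>: "\<psi> \<in> formulas L" "\<And>e. range e \<subseteq> univ M \<Longrightarrow> sat M e \<psi> \<longleftrightarrow> R e"
    using assms(1) unfolding definable_def by auto
  define zs where "zs = sorted_list_of_set (fv \<psi> - {x})"
  have zs: "set zs = fv \<psi> - {x}" "distinct zs" by (simp_all add: zs_def finite_fv)
  have a: "range (a \<eta>) \<subseteq> univ M" for \<eta> using assms(2) by (simp add: antichain_tree_def)
  define b where "b \<eta> = map (a \<eta>) zs" for \<eta>
  have sat_b: "sat M (assign (assign (\<lambda>_. undefined) zs (b \<eta>)) [x] [c]) \<psi> \<longleftrightarrow>
      R (override_on (a \<eta>) f {x})" if "range f \<subseteq> univ M" "f x = c" for \<eta> c f
  proof -
    have "sat M (assign (assign (\<lambda>_. undefined) zs (b \<eta>)) [x] [c]) \<psi> \<longleftrightarrow>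
        sat M (override_on (a \<eta>) f {x}) \<psi>"
      by (rule sat_cong) (use that zs in \<open>auto simp: b_def assign_map assign_single override_on_def\<close>)
    moreover have "range (override_on (a \<eta>) f {x}) \<subseteq> univ M"
      using a[of \<eta>] that by (auto simp: override_on_def)
    ultimately show ?thesis using \<psi>(2) by simp
  qed
  have realizes_iff: "(\<exists>bs. realizes M [x] bs ((\<lambda>\<eta>. instance_of \<psi> zs (b \<eta>)) ` Z)) \<longleftrightarrow> consist M R {x} (a ` Z)" for Z
  proof
    assume "\<exists>bs. realizes M [x] bs ((\<lambda>\<eta>. instance_of \<psi> zs (b \<eta>)) ` Z)"
    then obtain c where c: "c \<in> univ M" "realizes M [x] [c] ((\<lambda>\<eta>. instance_of \<psi> zs (b \<eta>)) ` Z)"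
      by (auto simp: realizes_def tuples_def length_Suc_conv)
    show "consist M R {x} (a ` Z)"
      unfolding consist_def using c sat_b[of "\<lambda>_. c" c]
      by (intro exI[of _ "\<lambda>_. c"]) (auto simp: realizes_def instance_of_def)
  next
    assume "consist M R {x} (a ` Z)"
    then obtain f where f: "range f \<subseteq> univ M" "\<forall>p\<in>a ` Z. R (override_on p f {x})"
      unfolding consist_def by blast
    then have "realizes M [x] [f x] ((\<lambda>\<eta>. instance_of \<psi> zs (b \<eta>)) ` Z)"
      using sat_b[OF f(1) refl] by (auto simp: realizes_def instance_of_def tuples_def)
    then show "\<exists>bs. realizes M [x] bs ((\<lambda>\<eta>. instance_of \<psi> zs (b \<eta>)) ` Z)" by blast
  qed
  have "witnesses_ATP L M \<psi> [x] zs"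
    unfolding witnesses_ATP_def
  proof (intro conjI exI[of _ b] allI impI)
    show "b \<eta> \<in> tuples M (length zs)" for \<eta> using a by (auto simp: b_def tuples_def)
  next
    fix X :: "bool list set" assume X: "antichain X"
    show "consistent M [x] {instance_of \<psi> zs (b \<eta>) | \<eta>. \<eta> \<in> X}"
      unfolding consistent_def setcompr_eq_image Collect_mem_eq
    proof (intro allI impI)
      fix \<Sigma>\<^sub>0 assume "\<Sigma>\<^sub>0 \<subseteq> (\<lambda>\<eta>. instance_of \<psi> zs (b \<eta>)) ` X" "finite \<Sigma>\<^sub>0"
      then obtain Z where Z: "Z \<subseteq> X" "finite Z" "\<Sigma>\<^sub>0 = (\<lambda>\<eta>. instance_of \<psi> zs (b \<eta>)) ` Z"
        by (meson finite_subset_image)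
      then have "consist M R {x} (a ` Z)"
        using assms(2) X unfolding antichain_tree_def antichain_def
        by (auto intro: pairwise_subset)
      then show "\<exists>bs. realizes M [x] bs \<Sigma>\<^sub>0" using realizes_iff Z(3) by simp
    qed
  next
    fix \<eta> \<nu> :: "bool list" assume "prefix \<eta> \<nu> \<and> \<eta> \<noteq> \<nu>"
    then have "\<not> consist M R {x} (a ` {\<eta>, \<nu>})"
      using assms(2) by (auto simp: antichain_tree_def strict_prefix_def)
    then have "\<not> (\<exists>bs. realizes M [x] bs {instance_of \<psi> zs (b \<eta>), instance_of \<psi> zs (b \<nu>)})"
      using realizes_iff[of "{\<eta>, \<nu>}"] by simp
    then show "\<not> consistent M [x] {instance_of \<psi> zs (b \<eta>), instance_of \<psi> zs (b \<nu>)}"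
      unfolding consistent_def by blast
  qed (use \<psi> zs in auto)
  then show ?thesis by blast
qed

subsection \<open>Embeddings of the binary tree\<close>

text \<open>Both directions matter: comparable pairs and antichains are both preserved. Lengths and
  branching points may change, which gives the Ramsey arguments their freedom.\<close>

definition tree_emb :: "(bool list \<Rightarrow> bool list) \<Rightarrow> bool" where
  "tree_emb f \<longleftrightarrow> (\<forall>\<sigma> \<tau>. prefix (f \<sigma>) (f \<tau>) \<longleftrightarrow> prefix \<sigma> \<tau>)"

lemma tree_emb_comp: "tree_emb f \<Longrightarrow> tree_emb g \<Longrightarrow> tree_emb (f \<circ> g)"
  by (simp add: tree_emb_def)

lemma tree_emb_strict_prefix:
  assumes "tree_emb f" "strict_prefix \<sigma> \<tau>"
  shows "strict_prefix (f \<sigma>) (f \<tau>)"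
proof -
  have "prefix (f \<sigma>) (f \<tau>)" "\<not> prefix (f \<tau>) (f \<sigma>)"
    using assms by (auto simp: tree_emb_def strict_prefix_def dest: prefix_order.antisym)
  then show ?thesis by (auto simp: strict_prefix_def)
qed

lemma antichain_iff:
  "antichain X \<longleftrightarrow> (\<forall>\<sigma>\<in>X. \<forall>\<tau>\<in>X. prefix \<sigma> \<tau> \<longrightarrow> \<sigma> = \<tau>)"
  unfolding antichain_def pairwise_def parallel_def by blast

lemma tree_emb_antichain:
  assumes "tree_emb f" "antichain X"
  shows "antichain (f ` X)"
  using assms unfolding antichain_iff tree_emb_def by (simp add: ball_simps) metis

section \<open>Characteristic strings and the first difference of two strings\<close>

definition bits :: "nat \<Rightarrow> nat set \<Rightarrow> bool list" where
  "bits n T = map (\<lambda>j. j \<in> T) [0..<n]"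

lemma length_bits [simp]: "length (bits n T) = n"
  by (simp add: bits_def)

lemma nth_bits [simp]: "j < n \<Longrightarrow> bits n T ! j \<longleftrightarrow> j \<in> T"
  by (simp add: bits_def)

lemma prefix_nth_iff: "prefix xs ys \<longleftrightarrow> length xs \<le> length ys \<and> (\<forall>i<length xs. xs ! i = ys ! i)"
proof
  assume "prefix xs ys"
  then show "length xs \<le> length ys \<and> (\<forall>i<length xs. xs ! i = ys ! i)"
    by (auto simp: prefix_def nth_append)
next
  assume "length xs \<le> length ys \<and> (\<forall>i<length xs. xs ! i = ys ! i)"
  then have "xs = take (length xs) ys" by (intro nth_equalityI) auto
  then show "prefix xs ys" by (metis take_is_prefix)
qed

lemma take_eq_iff:
  assumes "i \<le> length xs" "i \<le> length ys"
  shows "take i xs = take i ys \<longleftrightarrow> (\<forall>j<i. xs ! j = ys ! j)"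
  using assms by (simp add: list_eq_iff_nth_eq)

text \<open>The strings branch at level \<open>t\<close>, with \<open>x\<close> on the left. Level
  and side of branching carry the lexicographic order and the shape of a set of nodes.\<close>

definition Dif :: "bool list \<Rightarrow> bool list \<Rightarrow> nat \<Rightarrow> bool" where
  "Dif x y t \<longleftrightarrow> t < length x \<and> t < length y \<and> (\<forall>j<t. x ! j = y ! j) \<and> \<not> x ! t \<and> y ! t"

lemma Dif_take: "Dif (take l x) (take l y) t \<longleftrightarrow> t < l \<and> Dif x y t"
  by (auto simp: Dif_def)

lemma Dif_append: "Dif (p @ x) (p @ y) t \<longleftrightarrow> length p \<le> t \<and> Dif x y (t - length p)"
proof (cases "length p \<le> t")
  case True
  have "(\<forall>j<t. (p @ x) ! j = (p @ y) ! j) \<longleftrightarrow> (\<forall>j<t - length p. x ! j = y ! j)"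
  proof
    assume *: "\<forall>j<t. (p @ x) ! j = (p @ y) ! j"
    show "\<forall>j<t - length p. x ! j = y ! j"
      using *[rule_format, of "length p + j" for j] by auto
  next
    assume "\<forall>j<t - length p. x ! j = y ! j"
    then show "\<forall>j<t. (p @ x) ! j = (p @ y) ! j" by (auto simp: nth_append)
  qed
  moreover have "t < length (p @ z) \<longleftrightarrow> t - length p < length z" for z :: "bool list"
    using True by auto
  ultimately show ?thesis using True unfolding Dif_def by (simp add: nth_append)
qed (simp add: Dif_def nth_append)

lemma Dif_prefix:
  assumes "prefix x y"
  shows "\<not> Dif x y t" "\<not> Dif y x t"
  using assms unfolding Dif_def prefix_nth_iff by auto

lemma Dif_total:
  assumes "length x = length y" "x \<noteq> y"
  shows "\<exists>t. Dif x y t \<or> Dif y x t"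
proof -
  have ex: "\<exists>t. t < length x \<and> x ! t \<noteq> y ! t" using assms by (auto simp: list_eq_iff_nth_eq)
  define t where "t = (LEAST t. t < length x \<and> x ! t \<noteq> y ! t)"
  have t: "t < length x \<and> x ! t \<noteq> y ! t" unfolding t_def by (rule LeastI_ex[OF ex])
  have "x ! j = y ! j" if "j < t" for j
    using not_less_Least[of j "\<lambda>t. t < length x \<and> x ! t \<noteq> y ! t"] that t
    unfolding t_def[symmetric] by auto
  then show ?thesis using t assms(1) unfolding Dif_def by auto
qed

lemma take_eq_iff_Dif:
  assumes "i \<le> length x" "i \<le> length y"
  shows "take i x = take i y \<longleftrightarrow> (\<forall>t<i. \<not> Dif x y t \<and> \<not> Dif y x t)"
proof
  assume "take i x = take i y"
  then show "\<forall>t<i. \<not> Dif x y t \<and> \<not> Dif y x t"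
    using assms by (auto simp: take_eq_iff Dif_def)
next
  assume *: "\<forall>t<i. \<not> Dif x y t \<and> \<not> Dif y x t"
  show "take i x = take i y"
  proof (rule ccontr)
    assume "take i x \<noteq> take i y"
    then obtain t where "Dif (take i x) (take i y) t \<or> Dif (take i y) (take i x) t"
      using Dif_total[of "take i x" "take i y"] assms by auto
    then show False using * by (auto simp: Dif_take)
  qed
qed

text \<open>\<open>code\<close> numbers the nodes level by level, and lexicographically within a level.\<close>

definition code :: "bool list \<Rightarrow> nat" where
  "code \<sigma> = foldl (\<lambda>n b. 2 * n + of_bool b) 1 \<sigma>"

text \<open>Reading \<open>s\<close> as binary digits after \<open>n\<close> stays inside a block of
  length \<open>2 ^ length s\<close> that belongs to \<open>n\<close>. Blocks of different
  \<open>n\<close> are disjoint, so earlier digits decide comparisons.\<close>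

lemma foldl_binary_bounds:
  "n * 2 ^ length s \<le> foldl (\<lambda>n b. 2 * n + of_bool b) n s \<and>
   foldl (\<lambda>n b. 2 * n + of_bool b) n s < Suc n * 2 ^ length (s :: bool list)"
proof (induction s arbitrary: n)
  case (Cons b s)
  let ?n = "2 * n + of_bool b"
  have "n * 2 ^ length (b # s) \<le> ?n * 2 ^ length s" by simp
  moreover have "Suc ?n * 2 ^ length s \<le> Suc n * 2 ^ length (b # s)"
  proof -
    have "Suc ?n \<le> Suc n * 2" by simp
    then have "Suc ?n * 2 ^ length s \<le> (Suc n * 2) * 2 ^ length s" by (rule mult_right_mono) simp
    then show ?thesis by simp
  qed
  ultimately show ?case using Cons.IH[of ?n] unfolding foldl_Cons by linarith
qed simp

lemma code_less_length:
  assumes "length \<sigma> < length \<tau>"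
  shows "code \<sigma> < code \<tau>"
proof -
  have "code \<sigma> < 2 * 2 ^ length \<sigma>" using foldl_binary_bounds[of 1 \<sigma>] by (simp add: code_def)
  also have "\<dots> = 2 ^ Suc (length \<sigma>)" by simp
  also have "\<dots> \<le> 2 ^ length \<tau>" using assms by (intro power_increasing) auto
  also have "\<dots> \<le> code \<tau>" using foldl_binary_bounds[of 1 \<tau>] by (simp add: code_def)
  finally show ?thesis .
qed

text \<open>At the branching the numbers become \<open>2 * p\<close> and \<open>Suc (2 * p)\<close>,
  and the blocks above these two do not overlap.\<close>

lemma code_less_Dif:
  assumes "length \<sigma> = length \<tau>" "Dif \<sigma> \<tau> t"
  shows "code \<sigma> < code \<tau>"
proof -
  have t: "t < length \<sigma>" "t < length \<tau>" "take t \<sigma> = take t \<tau>" "\<not> \<sigma> ! t" "\<tau> ! t"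
    using assms by (auto simp: Dif_def take_eq_iff)
  define p s s' where "p = code (take t \<sigma>)" and "s = drop (Suc t) \<sigma>" and "s' = drop (Suc t) \<tau>"
  have "\<sigma> = take t \<sigma> @ False # s" "\<tau> = take t \<sigma> @ True # s'"
    using id_take_nth_drop[OF t(1)] id_take_nth_drop[OF t(2)] t by (simp_all add: s_def s'_def)
  then have eq: "code \<sigma> = foldl (\<lambda>n b. 2 * n + of_bool b) (2 * p) s"
    "code \<tau> = foldl (\<lambda>n b. 2 * n + of_bool b) (Suc (2 * p)) s'"
    unfolding code_def p_def by (metis (no_types, lifting) foldl_append foldl_Cons of_bool_eq add_0_right Suc_eq_plus1)+
  have len: "length s = length s'" using assms by (simp add: s_def s'_def)
  have "code \<sigma> < Suc (2 * p) * 2 ^ length s"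
    unfolding eq using foldl_binary_bounds[of "2 * p" s] by blast
  also have "\<dots> \<le> code \<tau>"
    unfolding eq len using foldl_binary_bounds[of "Suc (2 * p)" s'] by blast
  finally show ?thesis .
qed

lemma inj_code: "code \<sigma> = code \<tau> \<longleftrightarrow> \<sigma> = \<tau>"
proof
  assume eq: "code \<sigma> = code \<tau>"
  then have len: "length \<sigma> = length \<tau>"
    using code_less_length[of \<sigma> \<tau>] code_less_length[of \<tau> \<sigma>] by linarith
  show "\<sigma> = \<tau>"
  proof (rule ccontr)
    assume "\<sigma> \<noteq> \<tau>"
    then obtain t where "Dif \<sigma> \<tau> t \<or> Dif \<tau> \<sigma> t" using Dif_total[OF len] by blast
    then show False
      using code_less_Dif[OF len] code_less_Dif[OF len[symmetric]] eq by fastforce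
  qed
qed simp

text \<open>This reduces the order of the numbers of initial segments to lengths and branching data,
  exactly the information that \<open>Lsim\<close> records.\<close>

lemma code_take_less_iff:
  assumes "i \<le> length x" "j \<le> length y"
  shows "code (take i x) < code (take j y) \<longleftrightarrow> i < j \<or> i = j \<and> (\<exists>t<i. Dif x y t)"
proof -
  have len: "length (take i x) = i" "length (take j y) = j" using assms by auto
  consider "i < j" | "j < i" | "i = j" by linarith
  then show ?thesis
  proof cases
    case 1
    then show ?thesis using code_less_length[of "take i x" "take j y"] len by simp
  next
    case 2
    then have "code (take j y) < code (take i x)"
      using len by (intro code_less_length) simp
    then show ?thesis using 2 by simp
  next
    case 3
    have l: "length (take i x) = length (take i y)" using len 3 by simp
    show ?thesis
    proof (cases "take i x = take i y")
      case True
      then show ?thesis using 3 take_eq_iff_Dif[of i x y] assms by auto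
    next
      case False
      then obtain t where t: "Dif (take i x) (take i y) t \<or> Dif (take i y) (take i x) t"
        using Dif_total[OF l] by blast
      have gt: "code (take i y) < code (take i x)" if "Dif (take i y) (take i x) t" for t
        using code_less_Dif[OF l[symmetric] that] .
      have lt: "code (take i x) < code (take i y)" if "Dif (take i x) (take i y) t" for t
        using code_less_Dif[OF l that] .
      show ?thesis
      proof
        assume "code (take i x) < code (take j y)"
        then have "Dif (take i x) (take i y) t" using t gt 3 by fastforce
        then show "i < j \<or> i = j \<and> (\<exists>t<i. Dif x y t)" using 3 by (auto simp: Dif_take)
      next
        assume "i < j \<or> i = j \<and> (\<exists>t<i. Dif x y t)"
        then obtain t' where "Dif (take i x) (take i y) t'" using 3 by (auto simp: Dif_take)
        then show "code (take i x) < code (take j y)" using lt 3 by simp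
      qed
    qed
  qed
qed

definition path_codes :: "bool list \<Rightarrow> nat set" where
  "path_codes \<sigma> = (\<lambda>i. code (take i \<sigma>)) ` {..length \<sigma>}"

lemma finite_path_codes [simp]: "finite (path_codes \<sigma>)"
  by (simp add: path_codes_def)

lemma code_in_path_codes: "code \<tau> \<in> path_codes \<sigma> \<longleftrightarrow> prefix \<tau> \<sigma>"
proof
  assume "code \<tau> \<in> path_codes \<sigma>"
  then show "prefix \<tau> \<sigma>"
    by (auto simp: path_codes_def inj_code take_is_prefix)
next
  assume "prefix \<tau> \<sigma>"
  then have "\<tau> = take (length \<tau>) \<sigma>" "length \<tau> \<le> length \<sigma>"
    by (auto simp: prefix_def)
  then show "code \<tau> \<in> path_codes \<sigma>" unfolding path_codes_def by (metis atMost_iff image_eqI)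
qed

lemma path_codes_le: "c \<in> path_codes \<sigma> \<Longrightarrow> c \<le> code \<sigma>"
proof -
  assume "c \<in> path_codes \<sigma>"
  then obtain i where i: "i \<le> length \<sigma>" "c = code (take i \<sigma>)" by (auto simp: path_codes_def)
  then show "c \<le> code \<sigma>"
    using code_less_length[of "take i \<sigma>" \<sigma>] by (cases "i = length \<sigma>") auto
qed

section \<open>Embeddings given by a renumbering of the nodes\<close>

definition chr :: "nat set \<Rightarrow> bool list" where
  "chr T = bits (Suc (Max T)) T"

text \<open>A node becomes the set of the numbers of its initial segments, moved by \<open>h\<close>
  and written as a characteristic string. Families of nodes thus turn into sets of natural numbers,
  to which Ramsey's theorem applies.\<close>

definition emb :: "(nat \<Rightarrow> nat) \<Rightarrow> bool list \<Rightarrow> bool list" where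
  "emb h \<sigma> = chr (h ` path_codes \<sigma>)"

lemma emb_eq:
  assumes "strict_mono h"
  shows "emb h \<sigma> = bits (Suc (h (code \<sigma>))) (h ` path_codes \<sigma>)"
proof -
  have "Max (h ` path_codes \<sigma>) = h (code \<sigma>)"
  proof (rule Max_eqI)
    show "y \<le> h (code \<sigma>)" if "y \<in> h ` path_codes \<sigma>" for y
      using that path_codes_le[of _ \<sigma>] strict_mono_less_eq[OF assms] by auto
    show "h (code \<sigma>) \<in> h ` path_codes \<sigma>"
      using code_in_path_codes[of \<sigma> \<sigma>] by blast
  qed simp
  then show ?thesis by (simp add: emb_def chr_def)
qed

text \<open>The last digit of \<open>emb h \<sigma>\<close> marks \<sigma> itself, so being a prefix
  forces \<sigma> onto the path of \<tau>. Conversely, initial segments of \<tau> longer than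
  \<sigma> have larger numbers and are marked beyond the end of
  \<open>emb h \<sigma>\<close>.\<close>

lemma tree_emb_emb:
  assumes h: "strict_mono h"
  shows "tree_emb (emb h)"
  unfolding tree_emb_def
proof (intro allI iffI)
  fix \<sigma> \<tau> assume "prefix (emb h \<sigma>) (emb h \<tau>)"
  moreover have "h (code \<sigma>) \<in> h ` path_codes \<sigma>" using code_in_path_codes[of \<sigma> \<sigma>] by blast
  ultimately have "h (code \<sigma>) \<in> h ` path_codes \<tau>"
    unfolding emb_eq[OF h] prefix_nth_iff by (metis length_bits lessI less_le_trans nth_bits)
  then have "code \<sigma> \<in> path_codes \<tau>"
    using inj_image_mem_iff[OF strict_mono_imp_inj_on[OF h]] by blast
  then show "prefix \<sigma> \<tau>" by (simp add: code_in_path_codes)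
next
  fix \<sigma> \<tau> :: "bool list" assume p: "prefix \<sigma> \<tau>"
  then have le: "code \<sigma> \<le> code \<tau>" using path_codes_le code_in_path_codes by blast
  have "j \<in> h ` path_codes \<sigma> \<longleftrightarrow> j \<in> h ` path_codes \<tau>" if "j < Suc (h (code \<sigma>))" for j
  proof
    assume "j \<in> h ` path_codes \<sigma>"
    then obtain i where "i \<le> length \<sigma>" "j = h (code (take i \<sigma>))" by (auto simp: path_codes_def)
    moreover have "prefix (take i \<sigma>) \<tau>" using p take_is_prefix prefix_order.trans by blast
    ultimately show "j \<in> h ` path_codes \<tau>" using code_in_path_codes by blast
  next
    assume "j \<in> h ` path_codes \<tau>"
    then obtain i where i: "i \<le> length \<tau>" "j = h (code (take i \<tau>))" by (auto simp: path_codes_def)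
    then have "h (code (take i \<tau>)) \<le> h (code \<sigma>)" using that by simp
    then have "\<not> code \<sigma> < code (take i \<tau>)" using strict_mono_less_eq[OF h] by simp
    then have "\<not> length \<sigma> < length (take i \<tau>)" using code_less_length by blast
    then have "i \<le> length \<sigma>" using i(1) by simp
    then have "take i \<tau> = take i \<sigma>" using p by (auto simp: prefix_def)
    then show "j \<in> h ` path_codes \<sigma>" using i(2) code_in_path_codes[of "take i \<sigma>" \<sigma>] take_is_prefix
      by (metis image_eqI)
  qed
  moreover have "h (code \<sigma>) \<le> h (code \<tau>)" using le strict_mono_less_eq[OF h] by simp
  ultimately show "prefix (emb h \<sigma>) (emb h \<tau>)"
    unfolding emb_eq[OF h] prefix_nth_iff by simp
qed

section \<open>Embeddings given by moving the levels\<close>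

definition stretch :: "(nat \<Rightarrow> nat) \<Rightarrow> bool list \<Rightarrow> bool list" where
  "stretch \<theta> \<sigma> = bits (\<theta> (length \<sigma>)) (\<theta> ` {i. i < length \<sigma> \<and> \<sigma> ! i})"

lemma length_stretch [simp]: "length (stretch \<theta> \<sigma>) = \<theta> (length \<sigma>)"
  by (simp add: stretch_def)

lemma nth_stretch:
  "j < \<theta> (length \<sigma>) \<Longrightarrow> stretch \<theta> \<sigma> ! j \<longleftrightarrow> (\<exists>i<length \<sigma>. j = \<theta> i \<and> \<sigma> ! i)"
  by (auto simp: stretch_def)

lemma nth_stretch_image:
  assumes "strict_mono \<theta>" "i < length \<sigma>"
  shows "stretch \<theta> \<sigma> ! \<theta> i \<longleftrightarrow> \<sigma> ! i"
proof -
  have "\<theta> i < \<theta> (length \<sigma>)" using assms strict_monoD by blast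
  then show ?thesis using nth_stretch assms strict_mono_eq[OF assms(1)] by auto
qed

lemma stretch_cong: "(\<And>i. i \<le> length \<sigma> \<Longrightarrow> \<theta> i = \<mu> i) \<Longrightarrow> stretch \<theta> \<sigma> = stretch \<mu> \<sigma>"
  unfolding stretch_def by (auto intro!: arg_cong2[where f = bits])

lemma stretch_comp:
  assumes "strict_mono \<theta>" "strict_mono \<mu>"
  shows "stretch \<theta> (stretch \<mu> \<sigma>) = stretch (\<theta> \<circ> \<mu>) \<sigma>"
proof (rule nth_equalityI)
  fix j assume j: "j < length (stretch \<theta> (stretch \<mu> \<sigma>))"
  have "(\<exists>i<\<mu> (length \<sigma>). j = \<theta> i \<and> stretch \<mu> \<sigma> ! i) \<longleftrightarrow> (\<exists>k<length \<sigma>. j = \<theta> (\<mu> k) \<and> \<sigma> ! k)"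
  proof
    assume "\<exists>i<\<mu> (length \<sigma>). j = \<theta> i \<and> stretch \<mu> \<sigma> ! i"
    then show "\<exists>k<length \<sigma>. j = \<theta> (\<mu> k) \<and> \<sigma> ! k" by (auto simp: nth_stretch)
  next
    assume "\<exists>k<length \<sigma>. j = \<theta> (\<mu> k) \<and> \<sigma> ! k"
    then obtain k where k: "k < length \<sigma>" "j = \<theta> (\<mu> k)" "\<sigma> ! k" by blast
    then have "\<mu> k < \<mu> (length \<sigma>)" using assms(2) strict_monoD by blast
    then show "\<exists>i<\<mu> (length \<sigma>). j = \<theta> i \<and> stretch \<mu> \<sigma> ! i"
      using k nth_stretch_image[OF assms(2) k(1)] by blast
  qed
  then show "stretch \<theta> (stretch \<mu> \<sigma>) ! j = stretch (\<theta> \<circ> \<mu>) \<sigma> ! j"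
    using j by (simp add: nth_stretch)
qed simp

lemma tree_emb_stretch:
  assumes l: "strict_mono \<theta>"
  shows "tree_emb (stretch \<theta>)"
  unfolding tree_emb_def
proof (intro allI iffI)
  fix \<sigma> \<tau> assume "prefix (stretch \<theta> \<sigma>) (stretch \<theta> \<tau>)"
  then have le: "\<theta> (length \<sigma>) \<le> \<theta> (length \<tau>)"
    and nth: "\<And>j. j < \<theta> (length \<sigma>) \<Longrightarrow> stretch \<theta> \<sigma> ! j = stretch \<theta> \<tau> ! j"
    by (auto simp: prefix_nth_iff)
  have len: "length \<sigma> \<le> length \<tau>" using le strict_mono_less_eq[OF l] by blast
  moreover have "\<sigma> ! i = \<tau> ! i" if "i < length \<sigma>" for i
    using nth[of "\<theta> i"] that len nth_stretch_image[OF l] strict_monoD[OF l that] by auto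
  ultimately show "prefix \<sigma> \<tau>" by (simp add: prefix_nth_iff)
next
  fix \<sigma> \<tau> :: "bool list" assume p: "prefix \<sigma> \<tau>"
  then have len: "length \<sigma> \<le> length \<tau>" and nth: "\<And>i. i < length \<sigma> \<Longrightarrow> \<sigma> ! i = \<tau> ! i"
    by (auto simp: prefix_nth_iff)
  have le: "\<theta> (length \<sigma>) \<le> \<theta> (length \<tau>)" using len strict_mono_less_eq[OF l] by blast
  have "stretch \<theta> \<sigma> ! j = stretch \<theta> \<tau> ! j" if j: "j < \<theta> (length \<sigma>)" for j
  proof -
    have "(\<exists>i<length \<sigma>. j = \<theta> i \<and> \<sigma> ! i) \<longleftrightarrow> (\<exists>i<length \<tau>. j = \<theta> i \<and> \<tau> ! i)"
      using nth len j strict_mono_less[OF l] by (metis less_le_trans)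
    then show ?thesis using j le by (simp add: nth_stretch)
  qed
  then show "prefix (stretch \<theta> \<sigma>) (stretch \<theta> \<tau>)" using le by (simp add: prefix_nth_iff)
qed

text \<open>Levels outside the range of \<theta> carry \<open>False\<close> in every stretched
  string, so branching happens at moved levels only.\<close>

lemma Dif_stretch:
  assumes l: "strict_mono \<theta>"
  shows "Dif (stretch \<theta> x) (stretch \<theta> y) t \<longleftrightarrow> (\<exists>s. t = \<theta> s \<and> Dif x y s)"
proof
  assume D: "Dif (stretch \<theta> x) (stretch \<theta> y) t"
  then have "t < \<theta> (length x)" "t < \<theta> (length y)" "stretch \<theta> y ! t" by (auto simp: Dif_def)
  then obtain s where s: "s < length y" "t = \<theta> s" "y ! s" by (auto simp: nth_stretch)
  have sx: "s < length x" using \<open>t < \<theta> (length x)\<close> s(2) strict_mono_less[OF l] by blast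
  have "\<not> x ! s" using D s(2) nth_stretch_image[OF l sx] by (simp add: Dif_def)
  moreover have "x ! j = y ! j" if "j < s" for j
    using D s that sx nth_stretch_image[OF l, of j x] nth_stretch_image[OF l, of j y]
      strict_monoD[OF l that] by (auto simp: Dif_def)
  ultimately show "\<exists>s. t = \<theta> s \<and> Dif x y s" using s sx by (auto simp: Dif_def)
next
  assume "\<exists>s. t = \<theta> s \<and> Dif x y s"
  then obtain s where s: "t = \<theta> s" "s < length x" "s < length y" "\<And>j. j < s \<Longrightarrow> x ! j = y ! j"
    "\<not> x ! s" "y ! s" by (auto simp: Dif_def)
  have t: "t < \<theta> (length x)" "t < \<theta> (length y)" using s strict_monoD[OF l] by auto
  have "stretch \<theta> x ! j = stretch \<theta> y ! j" if j: "j < t" for j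
  proof -
    have "(\<exists>i<length x. j = \<theta> i \<and> x ! i) \<longleftrightarrow> (\<exists>i<length y. j = \<theta> i \<and> y ! i)"
      using s(1-4) j strict_mono_less[OF l] by (metis less_trans)
    then show ?thesis using j t by (simp add: nth_stretch)
  qed
  then show "Dif (stretch \<theta> x) (stretch \<theta> y) t"
    using t s nth_stretch_image[OF l s(2)] nth_stretch_image[OF l s(3)] by (simp add: Dif_def)
qed

subsection \<open>Extracting a homogeneous tree\<close>

text \<open>
  The digits at positions where nothing branches do not matter for \<open>Lsim\<close>, so it preserves the
  order of the initial segments under \<open>code\<close> but not the nodes.
\<close>

definition Lsim :: "'k set \<Rightarrow> ('k \<Rightarrow> bool list) \<Rightarrow> ('k \<Rightarrow> bool list) \<Rightarrow> bool" where
  "Lsim U y y' \<longleftrightarrow> (\<forall>k\<in>U. length (y k) = length (y' k)) \<and>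
     (\<forall>k\<in>U. \<forall>k'\<in>U. \<forall>t. Dif (y k) (y k') t \<longleftrightarrow> Dif (y' k) (y' k') t)"

lemma Lsim_stretch:
  "strict_mono \<theta> \<Longrightarrow> Lsim U y y' \<Longrightarrow> Lsim U (stretch \<theta> \<circ> y) (stretch \<theta> \<circ> y')"
  unfolding Lsim_def by (simp add: Dif_stretch)

lemma strict_mono_comp: "strict_mono f \<Longrightarrow> strict_mono g \<Longrightarrow> strict_mono (f \<circ> g)"
  by (simp add: strict_mono_def)

lemma finite_lists_le: "finite {\<sigma> :: bool list. length \<sigma> \<le> n}"
  using finite_lists_length_le[of "UNIV :: bool set" n] by simp

lemma finite_lists_less: "finite {\<sigma> :: bool list. length \<sigma> < n}"
  by (rule finite_subset[OF _ finite_lists_le[of n]]) auto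

section \<open>Ramsey's theorem for numbers of nodes and for levels\<close>

lemma sorted_list_of_image_lessThan:
  fixes e :: "nat \<Rightarrow> nat"
  assumes "strict_mono e"
  shows "sorted_list_of_set (e ` {..<r}) = map e [0..<r]"
proof -
  have "e ` {..<r} = set (map e [0..<r])" by auto
  moreover have "sorted (map e [0..<r])"
    using assms by (auto simp: sorted_iff_nth_mono strict_mono_less_eq)
  moreover have "distinct (map e [0..<r])"
    using assms by (simp add: distinct_map strict_mono_imp_inj_on inj_on_subset)
  ultimately show ?thesis by (simp only: sorted_list_of_set.idem_if_sorted_distinct)
qed

lemma homogeneous_set:
  fixes col :: "nat set \<Rightarrow> 'c"
  assumes "finite C" "\<And>X. col X \<in> C"
  obtains H where "infinite H"
    "\<And>X Y. X \<subseteq> H \<Longrightarrow> finite X \<Longrightarrow> card X = r \<Longrightarrow> Y \<subseteq> H \<Longrightarrow> finite Y \<Longrightarrow> card Y = r \<Longrightarrow> col X = col Y"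
proof -
  obtain f :: "'c \<Rightarrow> nat" and n where f: "f ` C = {i. i < n}" "inj_on f C"
    using finite_imp_inj_to_nat_seg[OF assms(1)] by blast
  have "f (col X) < n" for X using f(1) assms(2)[of X] by blast
  then obtain H t where H: "infinite H" "\<And>X. X \<subseteq> H \<and> finite X \<and> card X = r \<Longrightarrow> f (col X) = t"
    using Ramsey[OF infinite_UNIV_nat, of r "f \<circ> col" n] by auto
  show thesis
  proof (rule that[OF H(1)])
    fix X Y assume "X \<subseteq> H" "finite X" "card X = r" "Y \<subseteq> H" "finite Y" "card Y = r"
    then have "f (col X) = f (col Y)" using H(2) by simp
    then show "col X = col Y" using inj_onD[OF f(2)] assms(2) by blast
  qed
qed

text \<open>The bound \<open>N\<close> comes before the colouring: in \<open>tree_ramsey\<close> the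
  colouring depends on a map \<open>h\<close> that is chosen when \<open>N\<close> is already
  fixed.\<close>

lemma finite_homogeneous_set:
  assumes "finite C"
  shows "\<exists>N :: nat. \<forall>col :: nat set \<Rightarrow> 'c. (\<forall>X. col X \<in> C) \<longrightarrow> (\<exists>H\<subseteq>{..<N}. card H = m \<and>
      (\<forall>X Y. X \<subseteq> H \<and> card X = r \<and> Y \<subseteq> H \<and> card Y = r \<longrightarrow> col X = col Y))"
proof -
  obtain f :: "'c \<Rightarrow> nat" and n where f: "f ` C = {i. i < n}" "inj_on f C"
    using finite_imp_inj_to_nat_seg[OF assms(1)] by blast
  obtain N :: nat where N: "partn_lst {..<N} (replicate n m) r" using ramsey_full by blast
  show ?thesis
  proof (intro exI[of _ N] allI impI)
    fix col :: "nat set \<Rightarrow> 'c" assume "\<forall>X. col X \<in> C"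
    then have col: "\<And>X. col X \<in> C" by blast
    have "f (col X) < n" for X using f(1) col[of X] by blast
    then have "f \<circ> col \<in> nsets {..<N} r \<rightarrow> {..<length (replicate n m)}" by simp
    then obtain i where "i < n" "monochromatic {..<N} (replicate n m ! i) r (f \<circ> col) i"
      using N unfolding partn_lst_def by auto
    then obtain H where H: "H \<in> nsets {..<N} m" "(f \<circ> col) ` nsets H r \<subseteq> {i}"
      unfolding monochromatic_def by auto
    then have fin: "finite H" "H \<subseteq> {..<N}" "card H = m" by (auto simp: nsets_def)
    have "col X = col Y" if "X \<subseteq> H" "card X = r" "Y \<subseteq> H" "card Y = r" for X Y
    proof -
      have "finite X" "finite Y" using that fin finite_subset by auto
      then have "X \<in> nsets H r" "Y \<in> nsets H r" using that by (auto simp: nsets_def)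
      then have "f (col X) = i" "f (col Y) = i" using H(2) by auto
      then show ?thesis using inj_onD[OF f(2)] col by metis
    qed
    then show "\<exists>H\<subseteq>{..<N}. card H = m \<and>
      (\<forall>X Y. X \<subseteq> H \<and> card X = r \<and> Y \<subseteq> H \<and> card Y = r \<longrightarrow> col X = col Y)"
      using fin by blast
  qed
qed

text \<open>An increasing map between finite sets turns into two strictly increasing sequences with
  common indices, so that both can be composed with an enumeration of a homogeneous set.\<close>

lemma increasing_extension:
  fixes D :: "nat set" and g :: "nat \<Rightarrow> nat"
  assumes D: "finite D" and g: "strict_mono_on D g"
  obtains e e' where "strict_mono e" "strict_mono e'" "e ` {..<card D} = D"
    "\<And>i. i < card D \<Longrightarrow> e' i = g (e i)"
proof -
  let ?l = "sorted_list_of_set D"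
  have l: "length ?l = card D" "set ?l = D" using D by simp_all
  \<comment> \<open>Beyond the elements of \<open>D\<close> both sequences continue as
    \<open>K + i\<close>, above \<open>D\<close> and its image.\<close>
  obtain K where "\<forall>x\<in>D \<union> g ` D. x < K" using D finite_nat_set_iff_bounded[of "D \<union> g ` D"] by auto
  then have K: "\<And>x. x \<in> D \<Longrightarrow> x < K" "\<And>x. x \<in> D \<Longrightarrow> g x < K" by auto
  define e where "e i = (if i < card D then ?l ! i else K + i)" for i
  define e' where "e' i = (if i < card D then g (?l ! i) else K + i)" for i
  have mem: "?l ! i \<in> D" if "i < card D" for i using l that nth_mem by metis
  have less: "?l ! i < ?l ! j" if "i < j" "j < card D" for i j
    using that l sorted_wrt_nth_less[OF strict_sorted_list_of_set, of i j D] by simp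
  have e: "strict_mono e"
  proof (rule strict_monoI)
    fix i j :: nat assume "i < j"
    then show "e i < e j" using less[of i j] K(1)[OF mem, of i]
      by (auto simp: e_def)
  qed
  have e': "strict_mono e'"
  proof (rule strict_monoI)
    fix i j :: nat assume ij: "i < j"
    show "e' i < e' j"
    proof (cases "j < card D")
      case True
      then show ?thesis using ij less[of i j] strict_mono_onD[OF g mem mem, of i j] by (simp add: e'_def)
    next
      case False
      then show ?thesis using ij K(2)[OF mem, of i] by (auto simp: e'_def)
    qed
  qed
  have "e ` {..<card D} = D"
  proof -
    have "e ` {..<card D} = (!) ?l ` {..<length ?l}" unfolding l(1) by (auto simp: e_def)
    also have "\<dots> = D" using l(2) by (simp add: nth_image[of "length ?l" ?l, simplified] lessThan_atLeast0)
    finally show ?thesis .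
  qed
  then show thesis by (rule that[OF e e']) (simp add: e_def e'_def)
qed

text \<open>By \<open>code_take_less_iff\<close> the numbers of initial segments are ordered in the
  same way for \<open>y\<close> and \<open>y'\<close>, so matching them is well defined and
  increasing.\<close>

lemma Lsim_code:
  assumes y: "Lsim U y y'"
  obtains g where
    "\<And>k i. k \<in> U \<Longrightarrow> i \<le> length (y k) \<Longrightarrow> g (code (take i (y k))) = code (take i (y' k))"
    "strict_mono_on (\<Union>k\<in>U. path_codes (y k)) g"
proof -
  have len: "length (y k) = length (y' k)" if "k \<in> U" for k using y that by (simp add: Lsim_def)
  have less: "code (take i (y k)) < code (take j (y k')) \<longleftrightarrow>
      code (take i (y' k)) < code (take j (y' k'))"
    if "k \<in> U" "k' \<in> U" "i \<le> length (y k)" "j \<le> length (y k')" for k k' i j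
    using that len y by (simp add: code_take_less_iff Lsim_def)
  have eq: "code (take i (y' k)) = code (take j (y' k'))"
    if "k \<in> U" "k' \<in> U" "i \<le> length (y k)" "j \<le> length (y k')"
      "code (take i (y k)) = code (take j (y k'))" for k k' i j
    using less[OF that(1-4)] less[OF that(2,1,4,3)] that(5) by simp
  define g where "g c = (SOME c'. \<exists>k\<in>U. \<exists>i\<le>length (y k). c = code (take i (y k)) \<and>
    c' = code (take i (y' k)))" for c
  have g: "g (code (take i (y k))) = code (take i (y' k))" if "k \<in> U" "i \<le> length (y k)" for k i
  proof -
    let ?P = "\<lambda>c'. \<exists>k'\<in>U. \<exists>j\<le>length (y k'). code (take i (y k)) = code (take j (y k')) \<and>
      c' = code (take j (y' k'))"
    have "?P (code (take i (y' k)))" using that by blast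
    then have "?P (g (code (take i (y k))))" unfolding g_def by (rule someI)
    then show ?thesis using eq that by metis
  qed
  moreover have "strict_mono_on (\<Union>k\<in>U. path_codes (y k)) g"
  proof (rule strict_mono_onI)
    fix c d assume "c \<in> (\<Union>k\<in>U. path_codes (y k))" "d \<in> (\<Union>k\<in>U. path_codes (y k))" "c < d"
    then obtain k i k' j where "k \<in> U" "i \<le> length (y k)" "c = code (take i (y k))"
      "k' \<in> U" "j \<le> length (y k')" "d = code (take j (y k'))"
      unfolding path_codes_def by blast
    then show "g c < g d" using g less \<open>c < d\<close> by simp
  qed
  ultimately show thesis by (rule that)
qed

text \<open>A family of nodes is described by a pattern \<open>s\<close> that tells which members of
  an increasing sequence of numbers mark which node. Colour finite sets of numbers by the patterns
  for which \<open>S\<close> holds: on a homogeneous set \<open>S\<close> depends on the pattern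
  alone, and families related by \<open>Lsim\<close> share a pattern.\<close>

lemma label_ramsey:
  fixes S :: "bool list set \<Rightarrow> (bool list \<Rightarrow> 'p) \<Rightarrow> bool" and a :: "bool list \<Rightarrow> 'p"
  assumes cong: "\<And>U r r'. (\<And>k. k \<in> U \<Longrightarrow> r k = r' k) \<Longrightarrow> S U r \<longleftrightarrow> S U r'"
  shows "\<exists>h. strict_mono h \<and>
    (\<forall>U y y'. U \<subseteq> {\<sigma>. length \<sigma> \<le> R} \<and> (\<forall>k\<in>U. length (y k) \<le> N) \<and> Lsim U y y' \<longrightarrow>
       (S U (a \<circ> emb h \<circ> y) \<longleftrightarrow> S U (a \<circ> emb h \<circ> y')))"
proof -
  define W where "W = {\<sigma> :: bool list. length \<sigma> \<le> R}"
  define D where "D = code ` {\<sigma>. length \<sigma> \<le> N}"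
  \<comment> \<open>All numbers on the paths of strings of length at most \<open>N\<close> fit into
    \<open>r\<close> places.\<close>
  define r where "r = card D"
  define P where "P e = (\<lambda>(U, s). S U (\<lambda>k. a (chr (e ` s k))))" for e :: "nat \<Rightarrow> nat" and s and U
  define C where "C = Pow W \<times> (W \<rightarrow>\<^sub>E Pow {..<r})"
  have finW: "finite W" and finD: "finite D"
    unfolding W_def D_def by (simp_all add: finite_lists_le)
  have "finite C" unfolding C_def using finW by (intro finite_cartesian_product finite_PiE) auto
  define col where "col X = {z \<in> C. P (\<lambda>i. sorted_list_of_set X ! i) z}" for X
  have "finite (Pow C)" "\<And>X. col X \<in> Pow C" using \<open>finite C\<close> by (auto simp: col_def)
  then obtain H where H: "infinite H"
    "\<And>X Y. X \<subseteq> H \<Longrightarrow> finite X \<Longrightarrow> card X = r \<Longrightarrow> Y \<subseteq> H \<Longrightarrow> finite Y \<Longrightarrow> card Y = r \<Longrightarrow> col X = col Y"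
    using homogeneous_set[of "Pow C" col r] by blast
  define h where "h = enumerate H"
  have h: "strict_mono h" "\<And>i. h i \<in> H"
    unfolding h_def using H(1) strict_mono_enumerate enumerate_in_set by blast+
  have colP: "z \<in> col (e ` {..<r}) \<longleftrightarrow> P e z" if e: "strict_mono e" and zC: "z \<in> C" for e z
  proof -
    obtain U s where z: "z = (U, s)" "U \<subseteq> W" "s \<in> W \<rightarrow>\<^sub>E Pow {..<r}"
      using zC unfolding C_def by auto
    have "(\<lambda>i. sorted_list_of_set (e ` {..<r}) ! i) ` s k = e ` s k" if "k \<in> U" for k
    proof (rule image_cong)
      fix i assume "i \<in> s k"
      then have "i < r" using z that by (auto simp: PiE_iff)
      then show "sorted_list_of_set (e ` {..<r}) ! i = e i"
        by (simp add: sorted_list_of_image_lessThan[OF e])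
    qed simp
    then have "P (\<lambda>i. sorted_list_of_set (e ` {..<r}) ! i) z \<longleftrightarrow> P e z"
      unfolding P_def z(1) prod.case by (intro cong) simp
    then show ?thesis using zC by (simp add: col_def)
  qed
  have inv: "P (h \<circ> e) z \<longleftrightarrow> P (h \<circ> e') z" if "strict_mono e" "strict_mono e'" "z \<in> C" for e e' z
  proof -
    have mono: "strict_mono (h \<circ> e)" "strict_mono (h \<circ> e')"
      using h(1) that(1,2) by (simp_all add: strict_mono_comp)
    have card: "card (f ` {..<r}) = r" if "strict_mono f" for f :: "nat \<Rightarrow> nat"
      using card_image[OF strict_mono_imp_inj_on[OF that], of "{..<r}"]
      by (simp add: card_image inj_on_subset[OF strict_mono_imp_inj_on[OF that]])
    have "col ((h \<circ> e) ` {..<r}) = col ((h \<circ> e') ` {..<r})"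
      using h(2) card[OF mono(1)] card[OF mono(2)] by (intro H(2)) auto
    then show ?thesis using colP[OF mono(1) that(3)] colP[OF mono(2) that(3)] by simp
  qed
  show ?thesis
  proof (intro exI[of _ h] conjI h(1) allI impI)
    fix U :: "bool list set" and y y' :: "bool list \<Rightarrow> bool list"
    assume "U \<subseteq> {\<sigma>. length \<sigma> \<le> R} \<and> (\<forall>k\<in>U. length (y k) \<le> N) \<and> Lsim U y y'"
    then have U: "U \<subseteq> {\<sigma>. length \<sigma> \<le> R}" and N: "\<And>k. k \<in> U \<Longrightarrow> length (y k) \<le> N"
      and sim: "Lsim U y y'" by auto
    define D' where "D' = (\<Union>k\<in>U. path_codes (y k))"
    obtain g where g: "\<And>k i. k \<in> U \<Longrightarrow> i \<le> length (y k) \<Longrightarrow> g (code (take i (y k))) = code (take i (y' k))"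
      "strict_mono_on D' g"
      using Lsim_code[OF sim] unfolding D'_def by metis
    have "D' \<subseteq> D" unfolding D'_def D_def path_codes_def using N by fastforce
    then have D': "finite D'" "card D' \<le> r"
      unfolding r_def using finD finite_subset card_mono by auto
    obtain e e' where e: "strict_mono e" "strict_mono e'" "e ` {..<card D'} = D'"
      "\<And>i. i < card D' \<Longrightarrow> e' i = g (e i)"
      using increasing_extension[OF D'(1) g(2)] by blast
    \<comment> \<open>The common pattern: read through \<open>e\<close> it yields the paths of
      \<open>y\<close>, read through \<open>e'\<close> those of \<open>y'\<close>.\<close>
    define s where "s = (\<lambda>k\<in>W. if k \<in> U then {i. i < card D' \<and> e i \<in> path_codes (y k)} else {})"
    have UW: "U \<subseteq> W" using U by (simp add: W_def)
    have "s \<in> W \<rightarrow>\<^sub>E Pow {..<r}" using D'(2) by (auto simp: s_def split: if_splits)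
    then have z: "(U, s) \<in> C" using UW by (simp add: C_def)
    have s: "s k = {i. i < card D' \<and> e i \<in> path_codes (y k)}" if "k \<in> U" for k
      using that UW by (auto simp: s_def)
    have es: "e ` s k = path_codes (y k)" if "k \<in> U" for k
    proof
      show "path_codes (y k) \<subseteq> e ` s k"
      proof
        fix c assume c: "c \<in> path_codes (y k)"
        then have "c \<in> D'" using that unfolding D'_def by blast
        then have "c \<in> e ` {..<card D'}" by (simp only: e(3))
        then show "c \<in> e ` s k" using c unfolding s[OF that] by blast
      qed
    qed (auto simp: s[OF that])
    have es': "e' ` s k = path_codes (y' k)" if "k \<in> U" for k
    proof -
      have "e' ` s k = (\<lambda>i. g (e i)) ` s k" using s[OF that] e(4) by (intro image_cong) auto
      also have "\<dots> = g ` path_codes (y k)" using es[OF that] by (metis image_image)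
      also have "\<dots> = (\<lambda>i. g (code (take i (y k)))) ` {..length (y k)}"
        by (simp add: path_codes_def image_image)
      also have "\<dots> = (\<lambda>i. code (take i (y' k))) ` {..length (y k)}"
        using g(1)[OF that] by (intro image_cong) auto
      also have "\<dots> = path_codes (y' k)" using sim that by (simp add: path_codes_def Lsim_def)
      finally show ?thesis .
    qed
    have "S U (a \<circ> emb h \<circ> y) \<longleftrightarrow> P (h \<circ> e) (U, s)"
      unfolding P_def prod.case by (rule cong) (simp add: emb_def es[symmetric] image_image)
    also have "\<dots> \<longleftrightarrow> P (h \<circ> e') (U, s)" by (rule inv[OF e(1,2) z])
    also have "\<dots> \<longleftrightarrow> S U (a \<circ> emb h \<circ> y')"
      unfolding P_def prod.case by (rule cong) (simp add: emb_def es'[symmetric] image_image)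
    finally show "S U (a \<circ> emb h \<circ> y) \<longleftrightarrow> S U (a \<circ> emb h \<circ> y')" .
  qed
qed

text \<open>Two changes are allowed at once: \<theta> moves the levels of the nodes, up to
  \<open>R\<close> at most, and \<open>Lsim\<close> then alters digits where nothing
  branches.\<close>

definition homogeneous ::
  "(bool list set \<Rightarrow> (bool list \<Rightarrow> 'p) \<Rightarrow> bool) \<Rightarrow> nat \<Rightarrow> (bool list \<Rightarrow> 'p) \<Rightarrow> bool" where
  "homogeneous S R q \<longleftrightarrow> (\<forall>U \<theta> y. U \<subseteq> {\<sigma>. length \<sigma> \<le> R} \<and> strict_mono \<theta> \<and>
     (\<forall>k\<in>U. \<theta> (length k) \<le> R) \<and> Lsim U (stretch \<theta>) y \<longrightarrow> (S U (q \<circ> y) \<longleftrightarrow> S U q))"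

text \<open>Ramsey's theorem is used twice: on numbers of nodes, to make \<open>S\<close> invariant
  under \<open>Lsim\<close>, and on levels, to make it invariant under stretching.\<close>

lemma tree_ramsey:
  fixes S :: "bool list set \<Rightarrow> (bool list \<Rightarrow> 'p) \<Rightarrow> bool" and a :: "bool list \<Rightarrow> 'p"
  assumes cong: "\<And>U r r'. (\<And>k. k \<in> U \<Longrightarrow> r k = r' k) \<Longrightarrow> S U r \<longleftrightarrow> S U r'"
  shows "\<exists>f. tree_emb f \<and> homogeneous S R (a \<circ> f)"
proof -
  define W where "W = {\<sigma> :: bool list. length \<sigma> \<le> R}"
  have "finite (Pow (Pow W))" by (simp add: W_def finite_lists_le)
  \<comment> \<open>Nodes of length at most \<open>R\<close> see the \<open>Suc R\<close> levels
    from \<open>0\<close> to \<open>R\<close>; \<open>2 * R + 1\<close> levels leave room for every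
    \<theta> after its adjustment to \<open>\<theta>'\<close> below.\<close>
  from finite_homogeneous_set[OF this, of "2 * R + 1" "Suc R"]
  obtain N where N: "\<forall>col :: nat set \<Rightarrow> bool list set set. (\<forall>X. col X \<in> Pow (Pow W)) \<longrightarrow>
      (\<exists>H\<subseteq>{..<N}. card H = 2 * R + 1 \<and>
      (\<forall>X Y. X \<subseteq> H \<and> card X = Suc R \<and> Y \<subseteq> H \<and> card Y = Suc R \<longrightarrow> col X = col Y))" ..
  obtain h where h: "strict_mono h"
    "\<forall>U y y'. U \<subseteq> {\<sigma>. length \<sigma> \<le> R} \<and> (\<forall>k\<in>U. length (y k) \<le> N) \<and> Lsim U y y' \<longrightarrow>
       (S U (a \<circ> emb h \<circ> y) \<longleftrightarrow> S U (a \<circ> emb h \<circ> y'))"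
    using label_ramsey[of S R N a, OF cong] by blast
  define b where "b = a \<circ> emb h"
  define col where "col X = {U \<in> Pow W. S U (b \<circ> stretch (\<lambda>i. sorted_list_of_set X ! i))}" for X
  have "col X \<in> Pow (Pow W)" for X by (auto simp: col_def)
  from N[rule_format, of col, OF this] obtain H where
    "H \<subseteq> {..<N} \<and> card H = 2 * R + 1 \<and>
      (\<forall>X Y. X \<subseteq> H \<and> card X = Suc R \<and> Y \<subseteq> H \<and> card Y = Suc R \<longrightarrow> col X = col Y)" ..
  note H = this[THEN conjunct1] this[THEN conjunct2, THEN conjunct1]
    and col_eq = this[THEN conjunct2, THEN conjunct2]
  have "finite H" using H(1) finite_subset by blast
  obtain \<Lambda> where \<Lambda>: "strict_mono \<Lambda>" "\<Lambda> ` {..<2 * R + 1} = H"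
    using increasing_extension[OF \<open>finite H\<close> strict_mono_on_ident] H(2) by metis
  have inv: "S U (b \<circ> stretch \<mu>) \<longleftrightarrow> S U (b \<circ> stretch \<mu>')"
    if "U \<subseteq> W" "strict_mono \<mu>" "strict_mono \<mu>'" "\<And>i. i \<le> R \<Longrightarrow> \<mu> i \<in> H" "\<And>i. i \<le> R \<Longrightarrow> \<mu>' i \<in> H"
    for U \<mu> \<mu>'
  proof -
    have *: "U \<in> col (\<mu> ` {..<Suc R}) \<longleftrightarrow> S U (b \<circ> stretch \<mu>)"
      "\<mu> ` {..<Suc R} \<subseteq> H" "card (\<mu> ` {..<Suc R}) = Suc R"
      if "strict_mono \<mu>" "\<And>i. i \<le> R \<Longrightarrow> \<mu> i \<in> H" for \<mu>
    proof -
      have "stretch (\<lambda>i. sorted_list_of_set (\<mu> ` {..<Suc R}) ! i) k = stretch \<mu> k" if "k \<in> U" for k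
      proof (rule stretch_cong)
        fix i assume "i \<le> length k"
        then have "i < Suc R" using that \<open>U \<subseteq> W\<close> by (auto simp: W_def)
        then show "sorted_list_of_set (\<mu> ` {..<Suc R}) ! i = \<mu> i"
          unfolding sorted_list_of_image_lessThan[OF \<open>strict_mono \<mu>\<close>]
          by (simp only: nth_map length_upt nth_upt diff_zero add_0)
      qed
      then have "S U (b \<circ> stretch (\<lambda>i. sorted_list_of_set (\<mu> ` {..<Suc R}) ! i)) \<longleftrightarrow> S U (b \<circ> stretch \<mu>)"
        by (intro cong) simp
      then show "U \<in> col (\<mu> ` {..<Suc R}) \<longleftrightarrow> S U (b \<circ> stretch \<mu>)"
        using \<open>U \<subseteq> W\<close> by (simp add: col_def)
      show "\<mu> ` {..<Suc R} \<subseteq> H" using that by auto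
      show "card (\<mu> ` {..<Suc R}) = Suc R"
        using card_image[OF inj_on_subset[OF strict_mono_imp_inj_on[OF \<open>strict_mono \<mu>\<close>] subset_UNIV], of "{..<Suc R}"]
        by simp
    qed
    show ?thesis
    proof -
      have "col (\<mu> ` {..<Suc R}) = col (\<mu>' ` {..<Suc R})"
        by (intro col_eq[rule_format] conjI *(2,3) that(2-5))
      then show ?thesis using *(1)[OF that(2,4)] *(1)[OF that(3,5)] by simp
    qed
  qed
  have \<Lambda>H: "\<Lambda> i \<in> H" if "i \<le> 2 * R" for i using \<Lambda>(2) that by auto
  define f where "f = emb h \<circ> stretch \<Lambda>"
  have "tree_emb f"
    unfolding f_def by (intro tree_emb_comp tree_emb_emb tree_emb_stretch h(1) \<Lambda>(1))
  moreover have "homogeneous S R (a \<circ> f)"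
    unfolding homogeneous_def
  proof (intro allI impI)
    fix U \<theta> and y :: "bool list \<Rightarrow> bool list"
    assume "U \<subseteq> {\<sigma>. length \<sigma> \<le> R} \<and> strict_mono \<theta> \<and> (\<forall>k\<in>U. \<theta> (length k) \<le> R) \<and>
      Lsim U (stretch \<theta>) y"
    then have U: "U \<subseteq> {\<sigma>. length \<sigma> \<le> R}" and \<theta>: "strict_mono \<theta>" "\<And>k. k \<in> U \<Longrightarrow> \<theta> (length k) \<le> R"
      and sim: "Lsim U (stretch \<theta>) y" by auto
    \<comment> \<open>Beyond the lengths of the nodes in \<open>U\<close> the values of \<theta> may
      exceed \<open>R\<close>. The change keeps the values at arguments up to \<open>R\<close>
      within \<open>2 * R\<close>, where \<Lambda> lands in \<open>H\<close>.\<close>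
    define \<theta>' where "\<theta>' i = (if \<theta> i \<le> R then \<theta> i else R + i)" for i
    have \<theta>': "strict_mono \<theta>'"
    proof (rule strict_monoI)
      fix i j :: nat assume "i < j"
      then have "\<theta> i < \<theta> j" using \<theta>(1) strict_monoD by blast
      then show "\<theta>' i < \<theta>' j" using \<open>i < j\<close> by (auto simp: \<theta>'_def)
    qed
    have \<theta>'H: "\<Lambda> (\<theta>' i) \<in> H" if "i \<le> R" for i
      using that by (intro \<Lambda>H) (auto simp: \<theta>'_def)
    have "stretch \<theta> k = stretch \<theta>' k" if "k \<in> U" for k
    proof (rule stretch_cong)
      fix i assume "i \<le> length k"
      then have "\<theta> i \<le> \<theta> (length k)" using strict_mono_less_eq[OF \<theta>(1)] by blast
      then show "\<theta> i = \<theta>' i" using \<theta>(2)[OF that] by (simp add: \<theta>'_def)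
    qed
    then have st: "stretch \<Lambda> (stretch \<theta> k) = stretch (\<Lambda> \<circ> \<theta>') k" if "k \<in> U" for k
      using that stretch_comp[OF \<Lambda>(1) \<theta>', of k] by simp
    have "S U (a \<circ> f \<circ> y) \<longleftrightarrow> S U (a \<circ> emb h \<circ> (stretch \<Lambda> \<circ> y))"
      by (simp add: f_def comp_assoc)
    also have "\<dots> \<longleftrightarrow> S U (a \<circ> emb h \<circ> (stretch \<Lambda> \<circ> stretch \<theta>))"
    proof (rule h(2)[rule_format, symmetric], intro conjI ballI U Lsim_stretch \<Lambda>(1) sim)
      fix k assume "k \<in> U"
      then have "\<Lambda> (\<theta> (length k)) \<in> H" using \<Lambda>H[of "\<theta> (length k)"] \<theta>(2)[of k] by simp
      then show "length ((stretch \<Lambda> \<circ> stretch \<theta>) k) \<le> N" using H(1) by auto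
    qed
    also have "\<dots> \<longleftrightarrow> S U (b \<circ> stretch (\<Lambda> \<circ> \<theta>'))"
      by (rule cong) (simp add: b_def st)
    also have "\<dots> \<longleftrightarrow> S U (b \<circ> stretch \<Lambda>)"
    proof (rule inv)
      show "U \<subseteq> W" using U by (simp add: W_def)
      show "strict_mono (\<Lambda> \<circ> \<theta>')" by (rule strict_mono_comp[OF \<Lambda>(1) \<theta>'])
    qed (use \<Lambda> \<theta>'H \<Lambda>H in auto)
    also have "\<dots> \<longleftrightarrow> S U (a \<circ> f)" by (simp add: b_def f_def comp_assoc)
    finally show "S U (a \<circ> f \<circ> y) \<longleftrightarrow> S U (a \<circ> f)" .
  qed
  ultimately show ?thesis by blast
qed

subsection \<open>Grafting a root below a full antichain\<close>

text \<open>\<open>\<Psi> b P\<close> stands for the consistency of the instances with parameters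
  \<open>P\<close> after \<open>b\<close> is substituted for the variable to be removed; the
  combinatorics treats it as an abstract relation.\<close>

definition full :: "('b \<Rightarrow> 'p set \<Rightarrow> bool) \<Rightarrow> bool list set \<Rightarrow> 'b \<Rightarrow> (bool list \<Rightarrow> 'p) \<Rightarrow> bool" where
  "full \<Psi> U b r \<longleftrightarrow> (\<forall>A\<subseteq>U. antichain A \<longrightarrow> \<Psi> b (r ` A))"

definition satisfied ::
  "('b \<Rightarrow> 'p set \<Rightarrow> bool) \<Rightarrow> 'b set \<Rightarrow> bool list set \<Rightarrow> (bool list \<Rightarrow> 'p) \<Rightarrow> bool" where
  "satisfied \<Psi> B U r \<longleftrightarrow> (\<exists>b\<in>B. full \<Psi> U b r)"

lemma full_cong:
  assumes "\<And>k. k \<in> U \<Longrightarrow> r k = r' k"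
  shows "full \<Psi> U b r \<longleftrightarrow> full \<Psi> U b r'"
proof -
  have "r ` A = r' ` A" if "A \<subseteq> U" for A using assms that by (intro image_cong) auto
  then show ?thesis unfolding full_def by metis
qed

lemma satisfied_cong:
  "(\<And>k. k \<in> U \<Longrightarrow> r k = r' k) \<Longrightarrow> satisfied \<Psi> B U r \<longleftrightarrow> satisfied \<Psi> B U r'"
  unfolding satisfied_def using full_cong by metis

definition inner_nodes :: "bool list set \<Rightarrow> bool list set" where
  "inner_nodes U = {u \<in> U. \<exists>v\<in>U. strict_prefix u v}"

text \<open>
  The level of an inner node is not the level of any other node, and no two nodes branch there.
  Hence shifting an inner node upwards until the next event does not change the shape of the set.
\<close>

definition generic :: "bool list set \<Rightarrow> bool" where
  "generic U \<longleftrightarrow> (\<forall>u\<in>inner_nodes U. \<forall>v\<in>U. v \<noteq> u \<longrightarrow>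
     length v \<noteq> length u \<and> (length u < length v \<longrightarrow> \<not> v ! length u))"

lemma strict_prefix_length: "strict_prefix x y \<Longrightarrow> length x < length y"
  by (rule prefix_length_less)

lemma antichain_of_no_inner_nodes: "inner_nodes U = {} \<Longrightarrow> antichain U"
  unfolding antichain_iff inner_nodes_def strict_prefix_def by blast

text \<open>\<open>comb\<close> spreads the tree out so that to every node there is a turn off the path to its successors.\<close>

definition comb :: "bool list \<Rightarrow> bool list" where
  "comb \<zeta> = concat (map (\<lambda>b. [False, b]) \<zeta>)"

lemma length_comb [simp]: "length (comb \<zeta>) = 2 * length \<zeta>"
  by (induction \<zeta>) (auto simp: comb_def)

lemma comb_strict_prefix:
  assumes "strict_prefix \<zeta> \<zeta>'"
  shows "prefix (comb \<zeta> @ [False]) (comb \<zeta>')"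
proof -
  obtain b s where "\<zeta>' = \<zeta> @ b # s" using assms by (rule strict_prefixE')
  then show ?thesis by (simp add: comb_def)
qed

lemma comb_parallel:
  assumes "\<zeta> \<parallel> \<zeta>'"
  shows "comb \<zeta> \<parallel> comb \<zeta>'"
proof -
  obtain as b bs c cs where "b \<noteq> c" "\<zeta> = as @ b # bs" "\<zeta>' = as @ c # cs"
    using parallel_decomp[OF assms] by blast
  then show ?thesis by (auto simp: comb_def parallel_def)
qed

text \<open>\<open>NA\<close> is the failure of ATP for \<open>full \<Psi> U\<close> in finite form:
  in a tree of height \<open>m\<close> with jointly consistent antichains, some comparable pair is
  consistent too. \<open>R\<close> must be large because the copies of \<open>U\<close> take
  \<open>2 * m + 1\<close> more levels and the induction hypothesis is applied to finitely many
  sets.\<close>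

lemma eventually_satisfied_step:
  fixes a :: "bool list \<Rightarrow> 'p" and \<Psi> :: "'b \<Rightarrow> 'p set \<Rightarrow> bool"
  assumes U: "finite U" "generic U" and inner: "inner_nodes U \<noteq> {}"
    and IH: "\<And>Y. finite Y \<Longrightarrow> generic Y \<Longrightarrow> card (inner_nodes Y) < card (inner_nodes U) \<Longrightarrow>
      \<forall>\<^sub>F R in sequentially. \<forall>f. tree_emb f \<and> homogeneous (satisfied \<Psi> B) R (a \<circ> f) \<longrightarrow>
        satisfied \<Psi> B Y (a \<circ> f)"
    and NA: "\<And>r. (\<And>\<zeta> k. r \<zeta> k \<in> range a) \<Longrightarrow>
      (\<And>Z. Z \<subseteq> {\<zeta>. length \<zeta> < m} \<Longrightarrow> antichain Z \<Longrightarrow> \<exists>b\<in>B. \<forall>\<zeta>\<in>Z. full \<Psi> U b (r \<zeta>)) \<Longrightarrow>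
      \<exists>\<zeta> \<zeta>'. length \<zeta>' < m \<and> strict_prefix \<zeta> \<zeta>' \<and> (\<exists>b\<in>B. full \<Psi> U b (r \<zeta>) \<and> full \<Psi> U b (r \<zeta>'))"
  shows "\<forall>\<^sub>F R in sequentially. \<forall>f. tree_emb f \<and> homogeneous (satisfied \<Psi> B) R (a \<circ> f) \<longrightarrow>
    satisfied \<Psi> B U (a \<circ> f)"
proof -

  \<comment> \<open>A longest inner node and the leaves above it\<close>
  have fin_inner: "finite (inner_nodes U)" using U(1) by (simp add: inner_nodes_def)
  obtain w where w: "w \<in> inner_nodes U" and longest: "\<And>u. u \<in> inner_nodes U \<Longrightarrow> length u \<le> length w"
  proof -
    have "Max (length ` inner_nodes U) \<in> length ` inner_nodes U"
      using fin_inner inner by (intro Max_in) auto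
    then obtain w where "w \<in> inner_nodes U" "length w = Max (length ` inner_nodes U)" by auto
    then show thesis using that[of w] fin_inner by auto
  qed
  have wU: "w \<in> U" using w by (simp add: inner_nodes_def)
  define l where "l = length w"
  have gen_w: "length k \<noteq> l" "l < length k \<Longrightarrow> \<not> k ! l" if "k \<in> U" "k \<noteq> w" for k
    using U(2) w that unfolding generic_def l_def by blast+
  \<comment> \<open>By genericity no other node has the length of \<open>w\<close>, so all other
    inner nodes are strictly shorter.\<close>
  have short: "k \<noteq> w \<Longrightarrow> length k < l" if "k \<in> inner_nodes U" for k
    using longest[OF that] gen_w(1)[of k] that unfolding l_def inner_nodes_def by fastforce
  have above: "prefix w k \<longleftrightarrow> take l k = w" if "l \<le> length k" for k
    unfolding l_def using that by (metis append_eq_conv_conj l_def prefix_def take_is_prefix)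
  have top: "\<not> strict_prefix k k'" if "k \<in> U" "k' \<in> U" "l < length k" for k k'
    using short[of k] that gen_w(1)[of k] unfolding inner_nodes_def l_def by fastforce
  \<comment> \<open>The \<open>True\<close> after \<open>comb \<zeta>\<close> turns away from the
    \<open>False\<close> with which combs of extensions of \<zeta> continue. The padding gives all
    \<open>c \<zeta>\<close> with \<open>length \<zeta> < m\<close> the same length
    \<open>2 * m + 1\<close>.\<close>
  define c where "c \<zeta> = comb \<zeta> @ True # replicate (2 * m - 2 * length \<zeta>) False" for \<zeta>
  have len_c: "length (c \<zeta>) = 2 * m + 1" if "length \<zeta> < m" for \<zeta> using that by (simp add: c_def)
  \<comment> \<open>\<open>z \<zeta>\<close> detaches \<open>w\<close> from the nodes above it, but \<open>z \<zeta> w\<close> lies below their copies under \<open>z \<zeta>'\<close>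
    whenever \<open>\<zeta>\<close> is a proper initial segment of \<open>\<zeta>'\<close>.\<close>
  define z where "z \<zeta> k = (if length k < l then k
    else if k = w then w @ comb \<zeta> @ [False]
    else if prefix w k then w @ c \<zeta> @ drop l k
    else take l k @ replicate (2 * m + 1) False @ drop l k)" for \<zeta> k
  have z_short: "z \<zeta> k = k" if "length k < l" for \<zeta> k using that by (simp add: z_def)
  have z_take: "take l (z \<zeta> k) = take l k" "l \<le> length (z \<zeta> k)" if "l \<le> length k" for \<zeta> k
    using that above[OF that] by (auto simp: z_def l_def)
  have z_w: "z \<zeta> w = w @ comb \<zeta> @ [False]" for \<zeta> by (simp add: z_def l_def)
  have z_above: "z \<zeta> k = w @ c \<zeta> @ drop l k" if "prefix w k" "k \<noteq> w" for \<zeta> k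
    using that prefix_length_le[OF that(1)] by (simp add: z_def l_def)
  have z_side: "z \<zeta> k = take l k @ replicate (2 * m + 1) False @ drop l k"
    if "l \<le> length k" "\<not> prefix w k" for \<zeta> k
    using that by (auto simp: z_def)
  \<comment> \<open>Copies indexed by an antichain acquire no new comparabilities and lose those
    that start at \<open>w\<close>: above \<open>w\<close> different indices part within their
    combs, and for one index the copy of \<open>w\<close> ends in \<open>False\<close> where the
    leaves turn to \<open>True\<close>.\<close>
  have z_prefix: "strict_prefix k k' \<and> k \<noteq> w"
    if k: "k \<in> U" "k' \<in> U" and len: "length \<zeta> < m" "length \<zeta>' < m" and \<zeta>: "\<zeta> = \<zeta>' \<or> \<zeta> \<parallel> \<zeta>'"
      and pre: "prefix (z \<zeta> k) (z \<zeta>' k')" and ne: "z \<zeta> k \<noteq> z \<zeta>' k'" for k k' \<zeta> \<zeta>'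
  proof (cases "length k < l")
    case True
    have "prefix k k'"
    proof (cases "length k' < l")
      case False
      have "prefix k (take l (z \<zeta>' k'))"
        using pre True unfolding z_short[OF True] by (auto simp: prefix_def)
      then have "prefix k (take l k')" using z_take(1)[of k' \<zeta>'] False by simp
      then show ?thesis using take_is_prefix prefix_order.trans by blast
    qed (use pre True z_short in simp)
    moreover have "k \<noteq> k'" using ne True z_short by auto
    ultimately show ?thesis using True by (auto simp: strict_prefix_def l_def)
  next
    case False
    then have lk: "l \<le> length k" by simp
    have lk': "l \<le> length k'"
    proof (rule ccontr)
      assume "\<not> l \<le> length k'"
      then show False using prefix_length_le[OF pre] z_take(2)[OF lk, of \<zeta>] z_short[of k' \<zeta>'] by simp
    qed
    have eq: "take l k = take l k'"
    proof -
      have "take l (z \<zeta> k) = take l (z \<zeta>' k')"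
        using pre z_take(2)[OF lk, of \<zeta>] by (auto simp: prefix_def)
      then show ?thesis using z_take(1)[OF lk, of \<zeta>] z_take(1)[OF lk', of \<zeta>'] by simp
    qed
    have par: "comb \<zeta> @ x \<parallel> comb \<zeta>' @ y" if "\<zeta> \<noteq> \<zeta>'" for x y
      using \<zeta> that comb_parallel parallel_append by blast
    show ?thesis
    proof (cases "prefix w k")
      case True
      then have pk': "prefix w k'" using eq above[OF lk] above[OF lk'] by simp
      consider "k = w" "k' = w" | "k = w" "k' \<noteq> w" | "k \<noteq> w" "k' = w" | "k \<noteq> w" "k' \<noteq> w" by blast
      then show ?thesis
      proof cases
        case 1
        then have "\<zeta> \<noteq> \<zeta>'" using ne by auto
        then show ?thesis using pre par[of "[False]" "[False]"] 1 by (simp add: z_w parallel_def)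
      next
        case 2
        show ?thesis
        proof (cases "\<zeta> = \<zeta>'")
          case True
          then show ?thesis using pre 2 pk' by (simp add: z_w z_above c_def)
        next
          case False
          then show ?thesis using pre par[of "[False]" "True # replicate (2 * m - 2 * length \<zeta>') False @ drop l k'"]
              2 pk' by (simp add: z_w z_above c_def parallel_def)
        qed
      next
        case 3
        \<comment> \<open>Copies of \<open>w\<close> are shorter than those of the leaves above it,
          as \<open>length \<zeta>' < m\<close>.\<close>
        have "length (z \<zeta> k) \<le> length (z \<zeta>' k')" using pre by (rule prefix_length_le)
        then have "length w + (2 * m + 1) \<le> length w + (2 * length \<zeta>' + 1)"
          using 3 True len_c[OF len(1)] by (simp add: z_w z_above)
        then show ?thesis using len by simp
      next
        case 4
        show ?thesis
        proof (cases "\<zeta> = \<zeta>'")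
          case True
          then have "prefix (drop l k) (drop l k')" "k \<noteq> k'"
            using pre 4 \<open>prefix w k\<close> pk' ne by (auto simp: z_above)
          then have "strict_prefix k k'"
            using eq by (metis append_take_drop_id same_prefix_prefix strict_prefixI)
          moreover have "l < length k" using lk gen_w(1)[OF k(1) 4(1)] by simp
          ultimately show ?thesis using top k by blast
        next
          case False
          then show ?thesis
            using pre par[of "True # replicate (2 * m - 2 * length \<zeta>) False @ drop l k"
              "True # replicate (2 * m - 2 * length \<zeta>') False @ drop l k'"]
              4 \<open>prefix w k\<close> pk' by (simp add: z_above c_def parallel_def)
        qed
      qed
    next
      case False
      then have pk': "\<not> prefix w k'" using eq above[OF lk] above[OF lk'] by simp
      have "prefix (drop l k) (drop l k')" "k \<noteq> k'"
        using pre ne eq z_side[OF lk False, of \<zeta>] z_side[OF lk' pk', of \<zeta>'] by auto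
      then have "strict_prefix k k'"
        using eq by (metis append_take_drop_id same_prefix_prefix strict_prefixI)
      moreover have "k \<noteq> w" using False by auto
      ultimately show ?thesis by blast
    qed
  qed
  have z_inner: "z \<zeta> k = k \<and> k \<in> inner_nodes U \<and> k \<noteq> w \<and> length k < l"
    if k: "k \<in> U" "k' \<in> U" and len: "length \<zeta> < m" "length \<zeta>' < m" and \<zeta>: "\<zeta> = \<zeta>' \<or> \<zeta> \<parallel> \<zeta>'"
      and pre: "strict_prefix (z \<zeta> k) (z \<zeta>' k')" for k k' \<zeta> \<zeta>'
  proof -
    have "strict_prefix k k'" "k \<noteq> w"
      using z_prefix[OF k len \<zeta>] pre by (auto simp: strict_prefix_def)
    then have "k \<in> inner_nodes U" "k \<noteq> w" using k by (auto simp: inner_nodes_def)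
    then show ?thesis using short z_short by simp
  qed

  \<comment> \<open>The union of the copies along an antichain\<close>
  define Y where "Y Z = (\<Union>\<zeta>\<in>Z. z \<zeta> ` U)" for Z
  have \<zeta>_cases: "\<zeta> = \<zeta>' \<or> \<zeta> \<parallel> \<zeta>'" if "antichain Z" "\<zeta> \<in> Z" "\<zeta>' \<in> Z" for Z \<zeta> \<zeta>'
    using that unfolding antichain_def pairwise_def by blast
  \<comment> \<open>The copies of \<open>w\<close> have become leaves; the remaining inner nodes
    come from \<open>U\<close> and lie below level \<open>l\<close>, where nothing moves. The number
    of inner nodes drops, so the induction hypothesis applies.\<close>
  have Y_inner: "inner_nodes (Y Z) \<subseteq> inner_nodes U - {w}" "\<And>u. u \<in> inner_nodes (Y Z) \<Longrightarrow> length u < l"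
    if Z: "Z \<subseteq> {\<zeta>. length \<zeta> < m}" "antichain Z" for Z
  proof -
    have "u \<in> inner_nodes U - {w} \<and> length u < l" if u: "u \<in> inner_nodes (Y Z)" for u
    proof -
      obtain \<zeta> k \<zeta>' k' where *: "u = z \<zeta> k" "\<zeta> \<in> Z" "k \<in> U" "\<zeta>' \<in> Z" "k' \<in> U"
        "strict_prefix (z \<zeta> k) (z \<zeta>' k')"
        using u unfolding inner_nodes_def Y_def by blast
      have "length \<zeta> < m" "length \<zeta>' < m" using *(2,4) Z(1) by auto
      then show ?thesis using z_inner[OF *(3,5) _ _ \<zeta>_cases[OF Z(2) *(2,4)] *(6)] *(1) by simp
    qed
    then show "inner_nodes (Y Z) \<subseteq> inner_nodes U - {w}" "\<And>u. u \<in> inner_nodes (Y Z) \<Longrightarrow> length u < l"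
      by auto
  qed
  \<comment> \<open>Genericity is inherited because inner nodes lie below level \<open>l\<close>,
    where a copy agrees with its original.\<close>
  have Y_generic: "generic (Y Z)" if Z: "Z \<subseteq> {\<zeta>. length \<zeta> < m}" "antichain Z" for Z
    unfolding generic_def
  proof (intro ballI impI)
    fix u y assume u: "u \<in> inner_nodes (Y Z)" and y: "y \<in> Y Z" "y \<noteq> u"
    have u': "u \<in> inner_nodes U" "u \<noteq> w" "length u < l" using Y_inner[OF Z] u by auto
    obtain \<zeta> k where k: "y = z \<zeta> k" "k \<in> U" using y(1) unfolding Y_def by blast
    show "length y \<noteq> length u \<and> (length u < length y \<longrightarrow> \<not> y ! length u)"
    proof (cases "length k < l")
      case True
      then have "y = k" using k z_short by simp
      then show ?thesis using U(2) u' y(2) k(2) unfolding generic_def by blast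
    next
      case False
      then have "l \<le> length k" by simp
      note t = z_take[OF this, of \<zeta>]
      have "y ! length u = k ! length u"
        using t u'(3) unfolding k(1) by (metis nth_take)
      moreover have "\<not> k ! length u"
        using U(2) u' k(2) False unfolding generic_def by (metis less_le_trans not_le_imp_less)
      ultimately show ?thesis using t u'(3) k(1) by simp
    qed
  qed
  have "\<forall>\<^sub>F R in sequentially. \<forall>f. tree_emb f \<and> homogeneous (satisfied \<Psi> B) R (a \<circ> f) \<longrightarrow>
      satisfied \<Psi> B (Y Z) (a \<circ> f)" if Z: "Z \<subseteq> {\<zeta>. length \<zeta> < m}" "antichain Z" for Z
  proof (rule IH)
    have "finite Z" using Z(1) finite_lists_less finite_subset by blast
    then show "finite (Y Z)" using U(1) by (simp add: Y_def)
    show "generic (Y Z)" by (rule Y_generic[OF Z])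
    have "inner_nodes U - {w} \<subset> inner_nodes U" using w by blast
    then show "card (inner_nodes (Y Z)) < card (inner_nodes U)"
      using Y_inner(1)[OF Z] fin_inner by (meson order_le_less_trans psubset_card_mono)
  qed
  then have ev: "\<forall>\<^sub>F R in sequentially. \<forall>Z\<in>{Z. Z \<subseteq> {\<zeta>. length \<zeta> < m} \<and> antichain Z}.
      \<forall>f. tree_emb f \<and> homogeneous (satisfied \<Psi> B) R (a \<circ> f) \<longrightarrow> satisfied \<Psi> B (Y Z) (a \<circ> f)"
    by (intro eventually_ball_finite) (auto simp: finite_lists_less)
  have "\<forall>\<^sub>F R in sequentially. \<forall>k\<in>U. length k + (2 * m + 1) \<le> R"
    using U(1) by (intro eventually_ball_finite ballI eventually_ge_at_top)
  with ev show ?thesis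
  proof eventually_elim
    case (elim R)
    show ?case
    proof (intro allI impI)
      fix f assume f: "tree_emb f \<and> homogeneous (satisfied \<Psi> B) R (a \<circ> f)"

      \<comment> \<open>Gluing the copies at two comparable indices\<close>
      define q where "q = a \<circ> f"
      have "\<exists>\<zeta> \<zeta>'. length \<zeta>' < m \<and> strict_prefix \<zeta> \<zeta>' \<and>
          (\<exists>b\<in>B. full \<Psi> U b (q \<circ> z \<zeta>) \<and> full \<Psi> U b (q \<circ> z \<zeta>'))"
      proof (rule NA)
        show "(q \<circ> z \<zeta>) k \<in> range a" for \<zeta> k by (simp add: q_def)
      next
        fix Z assume Z: "Z \<subseteq> {\<zeta>. length \<zeta> < m}" "antichain Z"
        then have "satisfied \<Psi> B (Y Z) q" using elim(1) f unfolding q_def by blast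
        then obtain b where b: "b \<in> B" "full \<Psi> (Y Z) b q" unfolding satisfied_def by blast
        have "full \<Psi> U b (q \<circ> z \<zeta>)" if \<zeta>: "\<zeta> \<in> Z" for \<zeta>
          unfolding full_def
        proof (intro allI impI)
          fix A assume A: "A \<subseteq> U" "antichain A"
          have "antichain (z \<zeta> ` A)"
            unfolding antichain_iff
          proof (intro ballI impI, rule ccontr)
            fix x y assume xy: "x \<in> z \<zeta> ` A" "y \<in> z \<zeta> ` A" "prefix x y" "x \<noteq> y"
            then obtain k k' where k: "k \<in> A" "k' \<in> A" "x = z \<zeta> k" "y = z \<zeta> k'" by blast
            then have "strict_prefix k k'"
              using z_prefix[of k k' \<zeta> \<zeta>] A(1) xy Z(1) \<zeta> by auto
            then show False using A(2) k unfolding antichain_iff strict_prefix_def by blast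
          qed
          moreover have "z \<zeta> ` A \<subseteq> Y Z" using A(1) \<zeta> unfolding Y_def by blast
          ultimately have "\<Psi> b (q ` z \<zeta> ` A)" using b(2) unfolding full_def by blast
          then show "\<Psi> b ((q \<circ> z \<zeta>) ` A)" by (simp only: image_comp)
        qed
        then show "\<exists>b\<in>B. \<forall>\<zeta>\<in>Z. full \<Psi> U b (q \<circ> z \<zeta>)" using b(1) by blast
      qed
      then obtain \<zeta> \<zeta>' b where \<zeta>: "length \<zeta>' < m" "strict_prefix \<zeta> \<zeta>'" and b: "b \<in> B"
        "full \<Psi> U b (q \<circ> z \<zeta>)" "full \<Psi> U b (q \<circ> z \<zeta>')" by blast
      have \<zeta>m: "length \<zeta> < length \<zeta>'" using strict_prefix_length[OF \<zeta>(2)] .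
      \<comment> \<open>Taking \<open>w\<close> from the copy at \<zeta> and everything else from
        the copy at \<open>\<zeta>'\<close> puts \<open>w\<close> back below the leaves above
        it.\<close>
      define y where "y k = (if k = w then z \<zeta> w else z \<zeta>' k)" for k
      have z_eq: "z \<zeta> k = z \<zeta>' k" if "\<not> prefix w k" for k
        using that by (auto simp: z_def)
      have "full \<Psi> U b (q \<circ> y)"
        unfolding full_def
      proof (intro allI impI)
        fix A assume A: "A \<subseteq> U" "antichain A"
        \<comment> \<open>An antichain with \<open>w\<close> has no other node above
          \<open>w\<close>, and the two copies differ only above \<open>w\<close>; an antichain
          without \<open>w\<close> lies in the copy at \<open>\<zeta>'\<close>.\<close>
        have "y ` A = z \<zeta> ` A \<or> y ` A = z \<zeta>' ` A"
        proof (cases "w \<in> A")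
          case True
          then have "\<not> prefix w k" if "k \<in> A" "k \<noteq> w" for k
            using A(2) that unfolding antichain_iff by blast
          then have "y ` A = z \<zeta> ` A" using z_eq by (intro image_cong) (auto simp: y_def)
          then show ?thesis ..
        next
          case False
          then have "y ` A = z \<zeta>' ` A" by (intro image_cong) (auto simp: y_def)
          then show ?thesis ..
        qed
        then show "\<Psi> b ((q \<circ> y) ` A)"
        proof
          assume y: "y ` A = z \<zeta> ` A"
          have "\<Psi> b ((q \<circ> z \<zeta>) ` A)" using b(2) A unfolding full_def by blast
          then show ?thesis by (simp only: image_comp[symmetric] y)
        next
          assume y: "y ` A = z \<zeta>' ` A"
          have "\<Psi> b ((q \<circ> z \<zeta>') ` A)" using b(3) A unfolding full_def by blast
          then show ?thesis by (simp only: image_comp[symmetric] y)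
        qed
      qed
      then have "satisfied \<Psi> B U (q \<circ> y)" using b(1) unfolding satisfied_def by blast

      \<comment> \<open>The glued copy has the shape of \<open>U\<close>\<close>
      moreover have "satisfied \<Psi> B U (q \<circ> y) \<longleftrightarrow> satisfied \<Psi> B U q"
      proof -
        \<comment> \<open>Level \<open>l\<close>, at which \<open>w\<close> alone ends, moves to the
          length of \<open>z \<zeta> w\<close>; higher levels move by the length
          \<open>2 * m + 1\<close> of \<open>c \<zeta>'\<close>.\<close>
        define \<theta> where "\<theta> i = (if i < l then i else if i = l then l + (2 * length \<zeta> + 1)
          else i + (2 * m + 1))" for i
        have \<theta>: "strict_mono \<theta>"
          by (rule strict_monoI) (use \<zeta>m \<zeta>(1) in \<open>auto simp: \<theta>_def\<close>)
        have st_short: "stretch \<theta> k = k" if "length k < l" for k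
        proof (rule nth_equalityI)
          fix j assume "j < length (stretch \<theta> k)"
          then have "j < length k" using that by (simp add: \<theta>_def)
          then show "stretch \<theta> k ! j = k ! j"
            using nth_stretch_image[OF \<theta>, of j k] that by (simp add: \<theta>_def)
        qed (use that in \<open>simp add: \<theta>_def\<close>)
        have st_w: "stretch \<theta> w = w @ replicate (2 * length \<zeta> + 1) False"
        proof (rule nth_equalityI)
          fix j assume j: "j < length (stretch \<theta> w)"
          show "stretch \<theta> w ! j = (w @ replicate (2 * length \<zeta> + 1) False) ! j"
          proof (cases "j < l")
            case True
            then show ?thesis
              using nth_stretch_image[OF \<theta>, of j w] by (simp add: \<theta>_def l_def nth_append)
          next
            case False
            then have "\<not> (\<exists>i<length w. j = \<theta> i \<and> w ! i)" by (auto simp: \<theta>_def l_def)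
            then have "\<not> stretch \<theta> w ! j" using j by (simp add: nth_stretch)
            moreover have "j - length w < 2 * length \<zeta> + 1" "\<not> j < length w"
              using j False by (auto simp: \<theta>_def l_def)
            ultimately show ?thesis by (simp add: nth_append del: replicate_Suc)
          qed
        qed (simp add: \<theta>_def l_def)
        \<comment> \<open>The digit at level \<open>l\<close> is \<open>False\<close> by genericity,
          so it disappears among the digits \<open>False\<close> of the gap, and the result looks as
          if the whole block were inserted at \<open>l\<close>.\<close>
        have st_long: "stretch \<theta> k = take l k @ replicate (2 * m + 1) False @ drop l k"
          if k: "k \<in> U" "l < length k" for k
        proof (rule nth_equalityI)
          have k_l: "\<not> k ! l" using gen_w(2)[OF k(1) _ k(2)] k(2) by (auto simp: l_def)
          have len: "length (stretch \<theta> k) = length k + (2 * m + 1)" using k(2) by (simp add: \<theta>_def)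
          then show "length (stretch \<theta> k) = length (take l k @ replicate (2 * m + 1) False @ drop l k)"
            using k(2) by simp
          fix j assume j: "j < length (stretch \<theta> k)"
          let ?r = "take l k @ replicate (2 * m + 1) False @ drop l k"
          consider "j < l" | "l \<le> j" "j \<le> l + (2 * m + 1)" | "l + (2 * m + 1) < j" by linarith
          then show "stretch \<theta> k ! j = ?r ! j"
          proof cases
            case 1
            then show ?thesis
              using nth_stretch_image[OF \<theta>, of j k] k(2) by (simp add: \<theta>_def nth_append)
          next
            case 2
            have "\<not> (\<exists>i<length k. j = \<theta> i \<and> k ! i)"
            proof
              assume "\<exists>i<length k. j = \<theta> i \<and> k ! i"
              then obtain i where i: "j = \<theta> i" "k ! i" by blast
              then have "i \<noteq> l" using k_l by auto
              then show False using i(1) 2 by (auto simp: \<theta>_def split: if_splits)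
            qed
            then have "\<not> stretch \<theta> k ! j" using j by (simp add: nth_stretch)
            moreover have "\<not> ?r ! j"
            proof (cases "j = l + (2 * m + 1)")
              case True
              then show ?thesis using k(2) k_l by (simp add: nth_append)
            next
              case False
              then have "j - l < 2 * m + 1" using 2 by simp
              then show ?thesis using 2 k(2) by (simp add: nth_append del: replicate_Suc)
            qed
            ultimately show ?thesis by simp
          next
            case 3
            then obtain i where ji: "j = i + (2 * m + 1)" "l < i"
              by (intro that[of "j - (2 * m + 1)"]) linarith+
            have i: "\<theta> i = j" "i < length k" using ji j len by (auto simp: \<theta>_def)
            obtain d where d: "i = l + d" using ji(2) less_imp_add_positive by blast
            have "?r ! (l + ((2 * m + 1) + d)) = k ! i"
              using k(2) i(2) d by (simp add: nth_append del: replicate_Suc)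
            moreover have "l + ((2 * m + 1) + d) = j" using ji d by simp
            ultimately show ?thesis using nth_stretch_image[OF \<theta> i(2)] i(1) by simp
          qed
        qed
        have pre_w: "prefix (comb \<zeta> @ [False]) (c \<zeta>')"
          using comb_strict_prefix[OF \<zeta>(2)] unfolding c_def by (metis prefix_prefix)
        \<comment> \<open>Above \<open>w\<close> the set \<open>y\<close> carries the block
          \<open>c \<zeta>'\<close> where the stretched set carries \<open>False\<close>. All leaves
          above \<open>w\<close> share this block and the copy of \<open>w\<close> follows an
          initial segment of it, so nothing branches there and \<open>Lsim\<close> ignores the
          difference.\<close>
        have sim: "Lsim U (stretch \<theta>) y"
          unfolding Lsim_def
        proof (intro conjI ballI allI)
          have facts: "length (stretch \<theta> k) = length (y k)" "take l (stretch \<theta> k) = take l (y k)"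
            "take l (y k) = take l k" "length (y k) \<le> l \<Longrightarrow> length k < l"
            if k: "k \<in> U" for k
          proof -
            consider "length k < l" | "k = w" | "k \<noteq> w" "l < length k"
              using gen_w(1)[OF k] by linarith
            then have "length (stretch \<theta> k) = length (y k) \<and> take l (stretch \<theta> k) = take l (y k) \<and>
              take l (y k) = take l k \<and> (length (y k) \<le> l \<longrightarrow> length k < l)"
            proof cases
              case 1
              then show ?thesis by (auto simp: y_def z_short st_short l_def)
            next
              case 2
              then show ?thesis by (simp add: y_def z_w st_w l_def)
            next
              case 3
              then show ?thesis
                using len_c[OF \<zeta>(1)] z_take(1)[of k \<zeta>'] above[of k]
                by (cases "prefix w k") (auto simp: y_def z_above z_side st_long[OF k] l_def)
            qed
            then show "length (stretch \<theta> k) = length (y k)" "take l (stretch \<theta> k) = take l (y k)"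
              "take l (y k) = take l k" "length (y k) \<le> l \<Longrightarrow> length k < l" by auto
          qed
          show "length (stretch \<theta> k) = length (y k)" if "k \<in> U" for k using facts(1)[OF that] .
          fix k k' t assume k: "k \<in> U" "k' \<in> U"
          have small: "Dif (stretch \<theta> k) (stretch \<theta> k') t \<longleftrightarrow> Dif (y k) (y k') t" if "t < l"
            using that Dif_take[of l "stretch \<theta> k" "stretch \<theta> k'" t] Dif_take[of l "y k" "y k'" t]
              facts(2)[OF k(1)] facts(2)[OF k(2)] by simp
          show "Dif (stretch \<theta> k) (stretch \<theta> k') t \<longleftrightarrow> Dif (y k) (y k') t"
          proof (cases "t < l")
            case False
            then have t: "l \<le> t" by simp
            have no: "\<not> Dif x x' t" if "take l x \<noteq> take l x' \<or> length x \<le> l \<or> length x' \<le> l" for x x'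
              using that t unfolding Dif_def by (auto simp: list_eq_iff_nth_eq)
            show ?thesis
            proof (cases "take l k = take l k' \<and> l \<le> length k \<and> l \<le> length k'")
              case False
              then have "take l (y k) \<noteq> take l (y k') \<or> length (y k) \<le> l \<or> length (y k') \<le> l"
                using facts(3)[OF k(1)] facts(3)[OF k(2)] k
                by (auto simp: y_def z_short l_def)
              then show ?thesis using no facts(1,2)[OF k(1)] facts(1,2)[OF k(2)] by metis
            next
              case True
              show ?thesis
              proof (cases "prefix w k")
                case wk: True
                then have wk': "prefix w k'" using True above[of k] above[of k'] by simp
                have y_up: "y u = w @ c \<zeta>' @ drop l u" "stretch \<theta> u = w @ replicate (2 * m + 1) False @ drop l u"
                  if "u \<noteq> w" "prefix w u" "u \<in> U" for u
                proof -
                  have "l < length u" using gen_w(1)[of u] that prefix_length_le[OF that(2)]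
                    unfolding l_def by fastforce
                  then show "y u = w @ c \<zeta>' @ drop l u" "stretch \<theta> u = w @ replicate (2 * m + 1) False @ drop l u"
                    using st_long[OF that(3)] above[of u] that by (auto simp: y_def z_above)
                qed
                have w_up: "prefix (y w) (y u)" "prefix (stretch \<theta> w) (stretch \<theta> u)"
                  if "u \<noteq> w" "prefix w u" "u \<in> U" for u
                proof -
                  show "prefix (y w) (y u)"
                  proof -
                    have "y w = w @ (comb \<zeta> @ [False])" by (simp add: y_def z_w)
                    then show ?thesis
                      using prefix_prefix[OF pre_w] by (simp only: y_up(1)[OF that] same_prefix_prefix)
                  qed
                  have "prefix (replicate (2 * length \<zeta> + 1) False) (replicate (2 * m + 1) False)"
                    unfolding prefix_nth_iff using \<zeta>m \<zeta>(1) by (simp del: replicate_Suc)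
                  then show "prefix (stretch \<theta> w) (stretch \<theta> u)"
                    unfolding y_up(2)[OF that] st_w same_prefix_prefix by (rule prefix_prefix)
                qed
                consider "k = k'" | "k = w" "k' \<noteq> w" | "k \<noteq> w" "k' = w" | "k \<noteq> w" "k' \<noteq> w" by blast
                then show ?thesis
                proof cases
                  case 1
                  then show ?thesis by (simp add: Dif_def)
                next
                  case 2
                  then show ?thesis
                    using Dif_prefix(1)[OF w_up(1)[OF 2(2) wk' k(2)]]
                      Dif_prefix(1)[OF w_up(2)[OF 2(2) wk' k(2)]] by simp
                next
                  case 3
                  then show ?thesis
                    using Dif_prefix(2)[OF w_up(1)[OF 3(1) wk k(1)]]
                      Dif_prefix(2)[OF w_up(2)[OF 3(1) wk k(1)]] by simp
                next
                  case 4
                  have "Dif (y k) (y k') t \<longleftrightarrow> length (w @ c \<zeta>') \<le> t \<and>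
                      Dif (drop l k) (drop l k') (t - length (w @ c \<zeta>'))"
                    using Dif_append[of "w @ c \<zeta>'" "drop l k" "drop l k'" t]
                      y_up(1)[OF 4(1) wk k(1)] y_up(1)[OF 4(2) wk' k(2)] by simp
                  moreover have "Dif (stretch \<theta> k) (stretch \<theta> k') t \<longleftrightarrow>
                      length (w @ replicate (2 * m + 1) False) \<le> t \<and>
                      Dif (drop l k) (drop l k') (t - length (w @ replicate (2 * m + 1) False))"
                    using Dif_append[of "w @ replicate (2 * m + 1) False" "drop l k" "drop l k'" t]
                      y_up(2)[OF 4(1) wk k(1)] y_up(2)[OF 4(2) wk' k(2)] by (simp del: replicate_Suc)
                  ultimately show ?thesis using len_c[OF \<zeta>(1)] by simp
                qed
              next
                case False
                have "stretch \<theta> u = y u" if "u \<in> U" "\<not> prefix w u" "l \<le> length u" for u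
                proof -
                  have "u \<noteq> w" using that(2) by auto
                  then have "l < length u" using gen_w(1)[OF that(1)] that(3) by fastforce
                  then show ?thesis
                    using st_long[OF that(1)] z_side[OF that(3,2)] \<open>u \<noteq> w\<close> by (simp add: y_def)
                qed
                moreover have "\<not> prefix w k'" using True False above[of k] above[of k'] by simp
                ultimately show ?thesis using k False True by simp
              qed
            qed
          qed (rule small)
        qed
        have "\<theta> (length k) \<le> length k + (2 * m + 1)" for k :: "bool list"
          using \<zeta>m \<zeta>(1) by (simp add: \<theta>_def)
        then have "\<theta> (length k) \<le> R" if "k \<in> U" for k
          using elim(2) that order_trans by blast
        moreover have "U \<subseteq> {\<sigma>. length \<sigma> \<le> R}" using elim(2) by auto
        ultimately show ?thesis
          using f \<theta> sim unfolding homogeneous_def q_def by blast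
      qed
      ultimately show "satisfied \<Psi> B U (a \<circ> f)" unfolding q_def by simp
    qed
  qed
qed

text \<open>Induction on the number of inner nodes. Without any, \<open>U\<close> is an antichain,
  so is its image, and \<open>base\<close> applies.\<close>

lemma eventually_satisfied:
  fixes a :: "bool list \<Rightarrow> 'p" and \<Psi> :: "'b \<Rightarrow> 'p set \<Rightarrow> bool"
  assumes mono: "\<And>b P P'. \<Psi> b P \<Longrightarrow> P' \<subseteq> P \<Longrightarrow> \<Psi> b P'"
    and base: "\<And>X. finite X \<Longrightarrow> antichain X \<Longrightarrow> \<exists>b\<in>B. \<Psi> b (a ` X)"
    and NA: "\<And>U. finite U \<Longrightarrow> \<exists>m. \<forall>r. (\<forall>\<zeta> k. r \<zeta> k \<in> range a) \<and>
      (\<forall>Z. Z \<subseteq> {\<zeta>. length \<zeta> < m} \<and> antichain Z \<longrightarrow> (\<exists>b\<in>B. \<forall>\<zeta>\<in>Z. full \<Psi> U b (r \<zeta>))) \<longrightarrow>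
      (\<exists>\<zeta> \<zeta>'. length \<zeta>' < m \<and> strict_prefix \<zeta> \<zeta>' \<and> (\<exists>b\<in>B. full \<Psi> U b (r \<zeta>) \<and> full \<Psi> U b (r \<zeta>')))"
    and "finite U" "generic U"
  shows "\<forall>\<^sub>F R in sequentially. \<forall>f. tree_emb f \<and> homogeneous (satisfied \<Psi> B) R (a \<circ> f) \<longrightarrow>
    satisfied \<Psi> B U (a \<circ> f)"
  using \<open>finite U\<close> \<open>generic U\<close>
proof (induction "card (inner_nodes U)" arbitrary: U rule: less_induct)
  case less
  show ?case
  proof (cases "inner_nodes U = {}")
    case True
    have "satisfied \<Psi> B U (a \<circ> f)" if f: "tree_emb f" for f
    proof -
      have "antichain (f ` U)"
        using tree_emb_antichain[OF f antichain_of_no_inner_nodes[OF True]] .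
      then obtain b where b: "b \<in> B" "\<Psi> b (a ` f ` U)" using base[of "f ` U"] less.prems by auto
      have "\<Psi> b ((a \<circ> f) ` A)" if "A \<subseteq> U" for A
        using mono[OF b(2), of "(a \<circ> f) ` A"] that by (auto simp: image_comp)
      then show ?thesis using b(1) unfolding satisfied_def full_def by blast
    qed
    then show ?thesis by simp
  next
    case False
    obtain m where m: "\<forall>r. (\<forall>\<zeta> k. r \<zeta> k \<in> range a) \<and>
      (\<forall>Z. Z \<subseteq> {\<zeta>. length \<zeta> < m} \<and> antichain Z \<longrightarrow> (\<exists>b\<in>B. \<forall>\<zeta>\<in>Z. full \<Psi> U b (r \<zeta>))) \<longrightarrow>
      (\<exists>\<zeta> \<zeta>'. length \<zeta>' < m \<and> strict_prefix \<zeta> \<zeta>' \<and> (\<exists>b\<in>B. full \<Psi> U b (r \<zeta>) \<and> full \<Psi> U b (r \<zeta>')))"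
      using NA[OF less.prems(1)] ..
    show ?thesis
    proof (rule eventually_satisfied_step[OF less.prems False, where m = m])
      show "\<forall>\<^sub>F R in sequentially. \<forall>f. tree_emb f \<and> homogeneous (satisfied \<Psi> B) R (a \<circ> f) \<longrightarrow>
          satisfied \<Psi> B Y (a \<circ> f)"
        if "finite Y" "generic Y" "card (inner_nodes Y) < card (inner_nodes U)" for Y
        using less.hyps[OF that(3,1,2)] .
      show "\<exists>\<zeta> \<zeta>'. length \<zeta>' < m \<and> strict_prefix \<zeta> \<zeta>' \<and> (\<exists>b\<in>B. full \<Psi> U b (r \<zeta>) \<and> full \<Psi> U b (r \<zeta>'))"
        if "\<And>\<zeta> k. r \<zeta> k \<in> range a"
          "\<And>Z. Z \<subseteq> {\<zeta>. length \<zeta> < m} \<Longrightarrow> antichain Z \<Longrightarrow> \<exists>b\<in>B. \<forall>\<zeta>\<in>Z. full \<Psi> U b (r \<zeta>)" for r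
        by (rule m[rule_format]) (intro conjI allI impI, use that in simp_all)
    qed
  qed
qed

text \<open>Doubling makes the marked positions even while all lengths are odd, so no string carries
  \<open>True\<close> at the length of another; different nodes get different lengths.\<close>

lemma generic_emb_image: "generic (emb (\<lambda>i. 2 * i) ` V)"
  unfolding generic_def
proof (intro ballI impI)
  have h: "strict_mono (\<lambda>i :: nat. 2 * i)" by (simp add: strict_mono_def)
  fix u v assume "u \<in> inner_nodes (emb (\<lambda>i. 2 * i) ` V)" "v \<in> emb (\<lambda>i. 2 * i) ` V" "v \<noteq> u"
  then obtain \<sigma> \<tau> where u: "u = emb (\<lambda>i. 2 * i) \<sigma>" and v: "v = emb (\<lambda>i. 2 * i) \<tau>" and "\<sigma> \<noteq> \<tau>"
    by (auto simp: inner_nodes_def)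
  then have "code \<sigma> \<noteq> code \<tau>" by (simp add: inj_code)
  moreover have "\<not> v ! length u" if "length u < length v"
  proof -
    have "v ! length u \<longleftrightarrow> length u \<in> (\<lambda>i. 2 * i) ` path_codes \<tau>"
      using that unfolding v emb_eq[OF h] by simp
    moreover have "odd (length u)" unfolding u emb_eq[OF h] by simp
    ultimately show ?thesis by auto
  qed
  ultimately show "length v \<noteq> length u \<and> (length u < length v \<longrightarrow> \<not> v ! length u)"
    unfolding u v emb_eq[OF h] by simp
qed

text \<open>The full binary tree need not be generic, but its copy under \<open>emb\<close> with
  doubling is. A homogeneous embedding satisfies this copy, and composition brings the result
  back.\<close>

theorem full_binary_tree:
  fixes a :: "bool list \<Rightarrow> 'p" and \<Psi> :: "'b \<Rightarrow> 'p set \<Rightarrow> bool"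
  assumes mono: "\<And>b P P'. \<Psi> b P \<Longrightarrow> P' \<subseteq> P \<Longrightarrow> \<Psi> b P'"
    and base: "\<And>X. finite X \<Longrightarrow> antichain X \<Longrightarrow> \<exists>b\<in>B. \<Psi> b (a ` X)"
    and NA: "\<And>U. finite U \<Longrightarrow> \<exists>m. \<forall>r. (\<forall>\<zeta> k. r \<zeta> k \<in> range a) \<and>
      (\<forall>Z. Z \<subseteq> {\<zeta>. length \<zeta> < m} \<and> antichain Z \<longrightarrow> (\<exists>b\<in>B. \<forall>\<zeta>\<in>Z. full \<Psi> U b (r \<zeta>))) \<longrightarrow>
      (\<exists>\<zeta> \<zeta>'. length \<zeta>' < m \<and> strict_prefix \<zeta> \<zeta>' \<and> (\<exists>b\<in>B. full \<Psi> U b (r \<zeta>) \<and> full \<Psi> U b (r \<zeta>')))"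
  shows "\<exists>f. tree_emb f \<and> (\<exists>b\<in>B. \<forall>A\<subseteq>{\<sigma>. length \<sigma> < n}. antichain A \<longrightarrow> \<Psi> b (a ` f ` A))"
proof -
  let ?e = "emb (\<lambda>i. 2 * i)"
  define U where "U = ?e ` {\<sigma>. length \<sigma> < n}"
  have e: "tree_emb ?e" by (rule tree_emb_emb) (simp add: strict_mono_def)
  have "finite U" "generic U" unfolding U_def by (simp_all add: finite_lists_less generic_emb_image)
  have "\<forall>\<^sub>F R in sequentially. \<forall>f. tree_emb f \<and> homogeneous (satisfied \<Psi> B) R (a \<circ> f) \<longrightarrow>
    satisfied \<Psi> B U (a \<circ> f)"
  proof (rule eventually_satisfied)
    show "\<Psi> b P'" if "\<Psi> b P" "P' \<subseteq> P" for b P P' using mono that .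
    show "\<exists>b\<in>B. \<Psi> b (a ` X)" if "finite X" "antichain X" for X using base that .
  qed (fact NA \<open>finite U\<close> \<open>generic U\<close>)+
  then obtain R where R: "\<forall>f. tree_emb f \<and> homogeneous (satisfied \<Psi> B) R (a \<circ> f) \<longrightarrow>
      satisfied \<Psi> B U (a \<circ> f)"
    unfolding eventually_sequentially by blast
  obtain f where f: "tree_emb f" "homogeneous (satisfied \<Psi> B) R (a \<circ> f)"
    using tree_ramsey[of "satisfied \<Psi> B" R a, OF satisfied_cong] by blast
  then obtain b where b: "b \<in> B" "full \<Psi> U b (a \<circ> f)" using R unfolding satisfied_def by blast
  have "\<Psi> b (a ` (f \<circ> ?e) ` A)" if "A \<subseteq> {\<sigma>. length \<sigma> < n}" "antichain A" for A
  proof -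
    have "?e ` A \<subseteq> U" "antichain (?e ` A)"
      using that tree_emb_antichain[OF e] by (auto simp: U_def)
    then have "\<Psi> b ((a \<circ> f) ` ?e ` A)" using b(2) unfolding full_def by blast
    then show ?thesis by (simp add: image_image)
  qed
  then show ?thesis using b(1) tree_emb_comp[OF f(1) e] by blast
qed

subsection \<open>Removing one object variable\<close>

lemma override_on_insert_right:
  "x \<notin> X \<Longrightarrow> override_on p f (insert x X) = override_on (p(x := f x)) f X"
  by (auto simp: override_on_def)

text \<open>For each finite height \<open>full_binary_tree\<close> finds a value \<open>c\<close> of
  \<open>x\<close> that works for a copy of the tree; \<open>x\<close> becomes a parameter with
  value \<open>c\<close>, and compactness passes to infinite height.\<close>

lemma remove_variable:
  fixes M :: "('f, 'r, 'm) struct"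
  assumes sat: "finitely_saturated L M" and R: "definable L M UNIV R" and x: "x \<notin> X"
    and a: "antichain_tree M R (insert x X) UNIV a"
    and NATP: "\<And>Q b. definable L M UNIV Q \<Longrightarrow> \<not> antichain_tree M Q {0} UNIV b"
  shows "\<exists>a. antichain_tree M R X UNIV a"
proof -
  have ne: "univ M \<noteq> {}" using sat by (simp add: finitely_saturated_def)
  then obtain d where d: "d \<in> univ M" by auto
  define \<Psi> where "\<Psi> c P = consist M R X ((\<lambda>p. p(x := c)) ` P)" for c P
  have range_a: "range (a \<eta>) \<subseteq> univ M" for \<eta> using a by (simp add: antichain_tree_def)
  have mono: "\<Psi> c P'" if "\<Psi> c P" "P' \<subseteq> P" for c P P'
    using that unfolding \<Psi>_def by (meson consist_mono image_mono)
  have base: "\<exists>c\<in>univ M. \<Psi> c (a ` Z)" if Z: "finite Z" "antichain Z" for Z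
  proof -
    have "consist M R (insert x X) (a ` Z)" using a Z by (simp add: antichain_tree_def)
    then obtain f where f: "range f \<subseteq> univ M" "\<forall>p\<in>a ` Z. R (override_on p f (insert x X))"
      unfolding consist_def by blast
    then have "\<Psi> (f x) (a ` Z)"
      unfolding \<Psi>_def consist_def using x by (intro exI[of _ f]) (auto simp: override_on_insert_right)
    then show ?thesis using f(1) by blast
  qed
  have NA: "\<exists>m. \<forall>r. (\<forall>\<zeta> k. r \<zeta> k \<in> range a) \<and>
      (\<forall>Z. Z \<subseteq> {\<zeta>. length \<zeta> < m} \<and> antichain Z \<longrightarrow> (\<exists>c\<in>univ M. \<forall>\<zeta>\<in>Z. full \<Psi> U c (r \<zeta>))) \<longrightarrow>
      (\<exists>\<zeta> \<zeta>'. length \<zeta>' < m \<and> strict_prefix \<zeta> \<zeta>' \<and> (\<exists>c\<in>univ M. full \<Psi> U c (r \<zeta>) \<and> full \<Psi> U c (r \<zeta>')))"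
    if U: "finite U" for U
  proof -
    \<comment> \<open>Variable \<open>0\<close> is the object variable and stands for
      \<open>x\<close> in all parameter assignments; their other entries are stored from
      \<open>1\<close> on.\<close>
    define \<rho> where "\<rho> k v = (if v = x then 0 else Suc (to_nat (k, v)))" for k :: "bool list" and v :: nat
    define Q where "Q e \<longleftrightarrow> (\<forall>A\<in>{A. A \<subseteq> U \<and> antichain A}. consist M R X ((\<lambda>k v. e (\<rho> k v)) ` A))" for e
    have "definable L M UNIV Q"
      unfolding Q_def[abs_def]
    proof (rule definable_ball[OF ne])
      show "finite {A. A \<subseteq> U \<and> antichain A}" using U by simp
      show "definable L M UNIV (\<lambda>e. consist M R X ((\<lambda>k v. e (\<rho> k v)) ` A))"
        if "A \<in> {A. A \<subseteq> U \<and> antichain A}" for A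
        using that U finite_subset by (intro definable_consist[OF ne R]) auto
    qed
    \<comment> \<open>By compactness, the absence of an infinite tree for \<open>Q\<close> already
      shows at a finite height.\<close>
    then obtain m where m: "\<And>b. \<not> antichain_tree M Q {0} {\<zeta>. length \<zeta> < m} b"
      using antichain_tree_compact[OF sat] NATP by blast
    have key: "\<exists>\<zeta> \<zeta>'. length \<zeta>' < m \<and> strict_prefix \<zeta> \<zeta>' \<and> (\<exists>c\<in>univ M. full \<Psi> U c (r \<zeta>) \<and> full \<Psi> U c (r \<zeta>'))"
      if r: "\<And>\<zeta> k. r \<zeta> k \<in> range a"
        and cons: "\<And>Z. Z \<subseteq> {\<zeta>. length \<zeta> < m} \<Longrightarrow> antichain Z \<Longrightarrow> \<exists>c\<in>univ M. \<forall>\<zeta>\<in>Z. full \<Psi> U c (r \<zeta>)"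
      for r
    proof (rule ccontr)
      assume no: "\<not> ?thesis"
      \<comment> \<open>The whole family \<open>r \<zeta>\<close> is packed into one assignment.
        Place \<open>0\<close> is overridden by the object variable, so \<open>d\<close> is only a
        filler.\<close>
      define b where "b \<zeta> i = (case i of 0 \<Rightarrow> d | Suc n \<Rightarrow> (case from_nat n of (k, v) \<Rightarrow> r \<zeta> k v))"
        for \<zeta> i
      have r_univ: "r \<zeta> k v \<in> univ M" for \<zeta> k v
      proof -
        obtain \<eta> where "r \<zeta> k = a \<eta>" using r[of \<zeta> k] by blast
        then show ?thesis using range_a[of \<eta>] by auto
      qed
      have Q_iff: "Q (override_on (b \<zeta>) f {0}) \<longleftrightarrow> full \<Psi> U (f 0) (r \<zeta>)" for \<zeta> f
      proof -
        have "(\<lambda>v. override_on (b \<zeta>) f {0} (\<rho> k v)) = (r \<zeta> k)(x := f 0)" for k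
          by (auto simp: override_on_def \<rho>_def b_def)
        then show ?thesis by (simp add: Q_def full_def \<Psi>_def image_image imp_conjL)
      qed
      have consist_iff: "consist M Q {0} (b ` Z) \<longleftrightarrow> (\<exists>c\<in>univ M. \<forall>\<zeta>\<in>Z. full \<Psi> U c (r \<zeta>))" for Z
      proof
        assume "consist M Q {0} (b ` Z)"
        then obtain f where f: "range f \<subseteq> univ M" "\<forall>p\<in>b ` Z. Q (override_on p f {0})"
          unfolding consist_def by blast
        have "\<forall>\<zeta>\<in>Z. full \<Psi> U (f 0) (r \<zeta>)" using f(2) Q_iff by simp
        moreover have "f 0 \<in> univ M" using f(1) by auto
        ultimately show "\<exists>c\<in>univ M. \<forall>\<zeta>\<in>Z. full \<Psi> U c (r \<zeta>)" by blast
      next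
        assume "\<exists>c\<in>univ M. \<forall>\<zeta>\<in>Z. full \<Psi> U c (r \<zeta>)"
        then obtain c where "c \<in> univ M" "\<forall>\<zeta>\<in>Z. full \<Psi> U c (r \<zeta>)" by blast
        then have "\<forall>p\<in>b ` Z. Q (override_on p (\<lambda>_. c) {0})" using Q_iff by simp
        then show "consist M Q {0} (b ` Z)"
          unfolding consist_def using \<open>c \<in> univ M\<close> by (intro exI[of _ "\<lambda>_. c"]) auto
      qed
      have "antichain_tree M Q {0} {\<zeta>. length \<zeta> < m} b"
        unfolding antichain_tree_def
      proof (intro conjI ballI allI impI)
        show "range (b \<zeta>) \<subseteq> univ M" for \<zeta>
          using d r_univ by (auto simp: b_def split: nat.split prod.split)
        show "consist M Q {0} (b ` Z)" if "Z \<subseteq> {\<zeta>. length \<zeta> < m}" "finite Z \<and> antichain Z" for Z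
          unfolding consist_iff using cons that by blast
        show "\<not> consist M Q {0} {b \<zeta>, b \<zeta>'}"
          if "\<zeta> \<in> {\<zeta>. length \<zeta> < m}" "\<zeta>' \<in> {\<zeta>. length \<zeta> < m}" "strict_prefix \<zeta> \<zeta>'" for \<zeta> \<zeta>'
          using consist_iff[of "{\<zeta>, \<zeta>'}"] no that by auto
      qed
      then show False using m by blast
    qed
    show ?thesis
    proof (intro exI[of _ m] allI impI, elim conjE)
      fix r
      assume "\<forall>\<zeta> k. r \<zeta> k \<in> range a"
        "\<forall>Z. Z \<subseteq> {\<zeta>. length \<zeta> < m} \<and> antichain Z \<longrightarrow> (\<exists>c\<in>univ M. \<forall>\<zeta>\<in>Z. full \<Psi> U c (r \<zeta>))"
      from key[OF this(1)[rule_format] this(2)[rule_format, OF conjI]]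
      show "\<exists>\<zeta> \<zeta>'. length \<zeta>' < m \<and> strict_prefix \<zeta> \<zeta>' \<and>
        (\<exists>c\<in>univ M. full \<Psi> U c (r \<zeta>) \<and> full \<Psi> U c (r \<zeta>'))" .
    qed
  qed
  have "\<exists>a'. antichain_tree M R X {\<eta>. length \<eta> < n} a'" for n
  proof -
    have "\<exists>f. tree_emb f \<and> (\<exists>c\<in>univ M. \<forall>A\<subseteq>{\<sigma>. length \<sigma> < n}. antichain A \<longrightarrow> \<Psi> c (a ` f ` A))"
    proof (rule full_binary_tree)
      show "\<Psi> c P'" if "\<Psi> c P" "P' \<subseteq> P" for c P P' using mono that .
      show "\<exists>c\<in>univ M. \<Psi> c (a ` Z)" if "finite Z" "antichain Z" for Z using base that .
    qed (fact NA)
    then obtain f c where f: "tree_emb f" and c: "c \<in> univ M"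
      "\<And>A. A \<subseteq> {\<sigma>. length \<sigma> < n} \<Longrightarrow> antichain A \<Longrightarrow> \<Psi> c (a ` f ` A)" by blast
    define a' where "a' \<eta> = (a (f \<eta>))(x := c)" for \<eta>
    have "antichain_tree M R X {\<eta>. length \<eta> < n} a'"
      unfolding antichain_tree_def
    proof (intro conjI ballI allI impI)
      show "range (a' \<eta>) \<subseteq> univ M" for \<eta> using range_a[of "f \<eta>"] c(1) by (auto simp: a'_def)
      show "consist M R X (a' ` Z)" if "Z \<subseteq> {\<eta>. length \<eta> < n}" "finite Z \<and> antichain Z" for Z
        using c(2)[of Z] that by (simp add: \<Psi>_def a'_def image_image)
      show "\<not> consist M R X {a' \<eta>, a' \<nu>}" if "strict_prefix \<eta> \<nu>" for \<eta> \<nu>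
      proof
        assume "consist M R X {a' \<eta>, a' \<nu>}"
        then obtain g where g: "range g \<subseteq> univ M" "R (override_on (a' \<eta>) g X)" "R (override_on (a' \<nu>) g X)"
          unfolding consist_def by auto
        \<comment> \<open>A realization of the new pair, extended by the value \<open>c\<close> for
          \<open>x\<close>, realizes the original pair with \<open>x\<close> as an object
          variable.\<close>
        have eq: "override_on (a (f \<sigma>)) (g(x := c)) (insert x X) = override_on (a' \<sigma>) g X" for \<sigma>
          using x by (auto simp: a'_def override_on_def)
        have "range (g(x := c)) \<subseteq> univ M" using g(1) c(1) by auto
        then have "consist M R (insert x X) {a (f \<eta>), a (f \<nu>)}"
          unfolding consist_def using g eq by (intro exI[of _ "g(x := c)"]) auto
        then show False
          using a tree_emb_strict_prefix[OF f that] by (simp add: antichain_tree_def)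
      qed
    qed
    then show ?thesis by blast
  qed
  then show ?thesis by (rule antichain_tree_compact[OF sat R])
qed

text \<open>With no object variables left, consistency of a single instance is its truth, and two
  true instances are consistent together.\<close>

lemma no_antichain_tree_empty:
  "\<not> antichain_tree M R {} UNIV a"
proof
  assume a: "antichain_tree M R {} UNIV a"
  have "R (a \<eta>)" for \<eta>
  proof -
    have "consist M R {} (a ` {\<eta>})"
      using a unfolding antichain_tree_def
      by (metis antichain_def finite.emptyI finite.insertI pairwise_singleton subset_UNIV)
    then show ?thesis by (auto simp: consist_def)
  qed
  moreover have "range (a []) \<subseteq> univ M" using a by (simp add: antichain_tree_def)
  ultimately have "consist M R {} {a [], a [True]}"
    unfolding consist_def by (intro exI[of _ "a []"]) simp
  moreover have "strict_prefix [] [True]" by (simp add: strict_prefix_def)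
  ultimately show False using a by (simp add: antichain_tree_def)
qed

text \<open>Object variables are turned into parameters one at a time. If no predicate in one
  variable had a tree, this would go on down to the empty set of object variables, which is
  impossible.\<close>

lemma one_variable:
  assumes sat: "finitely_saturated L M" and R: "definable L M UNIV R"
    and "finite X" "antichain_tree M R X UNIV a"
  shows "\<exists>Q b. definable L M UNIV Q \<and> antichain_tree M Q {0} UNIV b"
  using assms(3,4)
proof (induction X arbitrary: a rule: finite_induct)
  case empty
  then show ?case using no_antichain_tree_empty by blast
next
  case (insert x X)
  show ?case
  proof (rule ccontr)
    assume no: "\<not> ?case"
    have "\<exists>a. antichain_tree M R X UNIV a"
      by (rule remove_variable[OF sat R insert.hyps(2) insert.prems]) (use no in blast)
    then show False using insert.IH no by blast
  qed
qed

theorem theorem3p17: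
  fixes L :: "('f, 'r) lang"
    and T :: "('f, 'r) form set"
    and \<kappa> :: "'k rel"
    and M :: "('f, 'r, 'm) struct"
  assumes "complete_theory L T"
    and "monster_model L T \<kappa> M"
    and "\<exists>\<phi> xs ys. witnesses_ATP L M \<phi> xs ys"
  shows "\<exists>\<psi> x zs. witnesses_ATP L M \<psi> [x] zs"
proof -
  have sat: "finitely_saturated L M"
    using assms(2) by (rule monster_model_finitely_saturated)
  then have ne: "univ M \<noteq> {}" by (simp add: finitely_saturated_def)
  obtain \<phi> xs ys where \<phi>: "witnesses_ATP L M \<phi> xs ys" using assms(3) by blast
  then have "definable L M UNIV (\<lambda>e. sat M e \<phi>)"
    unfolding definable_def witnesses_ATP_def by blast
  moreover obtain a where "antichain_tree M (\<lambda>e. sat M e \<phi>) (set xs) UNIV a"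
    using antichain_tree_of_witnesses_ATP[OF ne \<phi>] by blast
  ultimately obtain Q b where "definable L M UNIV Q" "antichain_tree M Q {0} UNIV b"
    using one_variable[OF sat] by blast
  then show ?thesis using witnesses_ATP_of_antichain_tree by blast
qed

end
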